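(* Let $\delta>0$ and let $(T_N)_{N\in\mathbb{N}}$ be a sequence with $T_N\in2\mathbb{N}$, $T_N\le N$, $T_N\to\infty$, and $T_N-\frac{\log N}{c_\delta}\to-\infty$ as $N\to\infty$. Then, under $\mathbf P^{T_N}_{N,\delta}$, as $N\to\infty$, $$\frac{S_N}{C_\delta\, e^{-c_\delta T_N/2}\,T_N\sqrt N}\Longrightarrow\mathcal N(0,1),$$ where $C_\delta:=(1-e^{-\delta})\sqrt{\frac{2e^\delta}{2-e^{-\delta}}}$.
   Context: $(S_n)_{n\ge0}$ is the simple symmetric random walk on $\mathbb{Z}$ started at $0$, with law $\mathbf P$. For $T\in2\mathbb{N}$, $N\in\mathbb{N}$, $\delta\in\mathbb{R}$, the polymer measure $\mathbf P^T_{N,\delta}$ is defined by $\frac{d\mathbf P^T_{N,\delta}}{d\mathbf P}(S)=\frac{\exp(\delta\sum_{i=1}^N\mathbf 1_{\{S_i\in T\mathbb Z\}})}{Z^T_{N,\delta}}$, with $Z^T_{N,\delta}$ the normalizing constant. The constant $c_\delta:=\frac{\delta}{2}+\log\sqrt{2-e^{-\delta}}$. $\Longrightarrow$ denotes convergence in law and $\mathcal N(0,1)$ the standard normal law. *)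

theory Defs
  imports "HOL-Probability.Probability"
begin

text \<open>Paths of the simple symmetric random walk up to time N, encoded by their
  step lists (steps in {-1,1}); S_i is the sum of the first i steps.\<close>

definition walks :: "nat \<Rightarrow> int list set" where
  "walks N = {xs. length xs = N \<and> set xs \<subseteq> {-1, 1}}"

definition walk_pos :: "int list \<Rightarrow> nat \<Rightarrow> int" where
  "walk_pos xs i = sum_list (take i xs)"

text \<open>Law P of the simple symmetric random walk restricted to the first N steps
  (uniform on the 2^N paths).\<close>

definition srw :: "nat \<Rightarrow> int list measure" where
  "srw N = measure_pmf (pmf_of_set (walks N))"

definition c_delta :: "real \<Rightarrow> real" where
  "c_delta \<delta> = \<delta> / 2 + ln (sqrt (2 - exp (- \<delta>)))"

definition C_delta :: "real \<Rightarrow> real" where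
  "C_delta \<delta> = (1 - exp (- \<delta>)) * sqrt (2 * exp \<delta> / (2 - exp (- \<delta>)))"

definition visits :: "nat \<Rightarrow> nat \<Rightarrow> int list \<Rightarrow> nat" where
  "visits T N xs = card {i \<in> {1..N}. int T dvd walk_pos xs i}"

definition partition_fn :: "nat \<Rightarrow> nat \<Rightarrow> real \<Rightarrow> real" where
  "partition_fn T N \<delta> = (\<integral>xs. exp (\<delta> * real (visits T N xs)) \<partial>srw N)"

definition polymer :: "nat \<Rightarrow> nat \<Rightarrow> real \<Rightarrow> int list measure" where
  "polymer T N \<delta> = density (srw N)
     (\<lambda>xs. ennreal (exp (\<delta> * real (visits T N xs)) / partition_fn T N \<delta>))"

end

theory Submission
  imports Defs "HOL-Real_Asymp.Real_Asymp"
begin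

text \<open>
  The proof computes the limit of the characteristic function. Since the weights are \<open>T\<close>-periodic,
  the weighted sum \<open>Z\<^sub>N(u)\<close> of \<open>exp (i u S\<^sub>N)\<close> is given by powers of a transfer operator on functions with
  \<open>f (x + T) = exp (i \<theta>) f x\<close>, where \<open>\<theta> = u T\<close>. As \<open>T\<close> is even, two steps of the walk act on the even
  sublattice, which we rescale to period \<open>M = T / 2\<close>. The two-step operator is self-adjoint, it has an
  explicit hyperbolic eigenfunction with eigenvalue \<open>(cosh s)\<^sup>2 > 1\<close>, and it is a contraction on the
  orthogonal complement because the pinning is a perturbation of rank one. Hence \<open>Z\<^sub>N(u)\<close> equals
  \<open>a (cosh s)\<^sup>N\<close> up to an error of order \<open>sqrt T\<close>, where \<open>a\<close> converges to the same nonzero limit for \<open>u\<close> and for \<open>0\<close>.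
  The equation for \<open>s\<close> shows that the logarithm of the eigenvalue drops by about
  \<open>(sinh c)\<^sup>2 \<theta>\<^sup>2 exp (- c T)\<close> when the twist \<open>\<theta>\<close> is switched on, which gives the variance since
  \<open>C\<^sup>2 = 2 (sinh c)\<^sup>2\<close>.
\<close>

section \<open>The two-step transfer operator\<close>

definition pin_weight :: "real \<Rightarrow> nat \<Rightarrow> int \<Rightarrow> real" where
  "pin_weight \<delta> M y = (if int M dvd y then exp \<delta> else 1)"

definition quasi_periodic :: "nat \<Rightarrow> real \<Rightarrow> (int \<Rightarrow> complex) \<Rightarrow> bool" where
  "quasi_periodic M \<theta> f \<longleftrightarrow> (\<forall>y. f (y + int M) = cis \<theta> * f y)"

definition pin_op :: "real \<Rightarrow> nat \<Rightarrow> (int \<Rightarrow> complex) \<Rightarrow> int \<Rightarrow> complex" where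
  "pin_op \<delta> M f y = of_real (pin_weight \<delta> M y) * (f (y + 1) + 2 * f y + f (y - 1)) / 4"

definition pin_inner :: "real \<Rightarrow> nat \<Rightarrow> (int \<Rightarrow> complex) \<Rightarrow> (int \<Rightarrow> complex) \<Rightarrow> complex" where
  "pin_inner \<delta> M f g = (\<Sum>i<M. f (int i) * cnj (g (int i)) / of_real (pin_weight \<delta> M (int i)))"

definition pin_norm2 :: "real \<Rightarrow> nat \<Rightarrow> (int \<Rightarrow> complex) \<Rightarrow> real" where
  "pin_norm2 \<delta> M f = (\<Sum>i<M. (cmod (f (int i)))\<^sup>2 / pin_weight \<delta> M (int i))"

definition pin_form :: "nat \<Rightarrow> (int \<Rightarrow> complex) \<Rightarrow> real" where
  "pin_form M f = (\<Sum>i<M. (cmod (f (int i) + f (int i + 1)))\<^sup>2 / 4)"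

lemma pin_weight_pos [simp]: "pin_weight \<delta> M y > 0"
  by (simp add: pin_weight_def)

lemma pin_weight_nonzero [simp]: "pin_weight \<delta> M y \<noteq> 0"
  by (simp add: pin_weight_def)

lemma pin_weight_add_period [simp]: "pin_weight \<delta> M (y + int M) = pin_weight \<delta> M y"
  by (simp add: pin_weight_def)

lemma pin_norm2_nonneg: "pin_norm2 \<delta> M f \<ge> 0"
  unfolding pin_norm2_def by (intro sum_nonneg divide_nonneg_pos) auto

lemma pin_form_nonneg: "pin_form M f \<ge> 0"
  unfolding pin_form_def by (intro sum_nonneg) auto

lemma pin_inner_self: "pin_inner \<delta> M f f = of_real (pin_norm2 \<delta> M f)"
  unfolding pin_inner_def pin_norm2_def of_real_sum
  by (intro sum.cong) (auto simp: complex_norm_square simp del: of_real_power)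

lemma pin_inner_lincomb_left:
  "pin_inner \<delta> M (\<lambda>y. a * f y + b * g y) h = a * pin_inner \<delta> M f h + b * pin_inner \<delta> M g h"
  unfolding pin_inner_def sum_distrib_left sum.distrib[symmetric]
  by (intro sum.cong) (auto simp: field_simps)

lemma cnj_pin_inner: "cnj (pin_inner \<delta> M f g) = pin_inner \<delta> M g f"
  unfolding pin_inner_def cnj_sum by (intro sum.cong) (auto simp: field_simps)

lemma pin_inner_lincomb_right:
  "pin_inner \<delta> M h (\<lambda>y. a * f y + b * g y) = cnj a * pin_inner \<delta> M h f + cnj b * pin_inner \<delta> M h g"
proof -
  have "pin_inner \<delta> M h (\<lambda>y. a * f y + b * g y) = cnj (pin_inner \<delta> M (\<lambda>y. a * f y + b * g y) h)"
    by (simp only: cnj_pin_inner)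
  also have "\<dots> = cnj a * pin_inner \<delta> M h f + cnj b * pin_inner \<delta> M h g"
    unfolding pin_inner_lincomb_left by (simp add: cnj_pin_inner)
  finally show ?thesis .
qed

lemma pin_op_lincomb:
  "pin_op \<delta> M (\<lambda>y. a * f y + b * g y) = (\<lambda>y. a * pin_op \<delta> M f y + b * pin_op \<delta> M g y)"
  by (rule ext) (simp add: pin_op_def field_simps)

lemma quasi_periodic_lincomb:
  assumes "quasi_periodic M \<theta> f" "quasi_periodic M \<theta> g"
  shows "quasi_periodic M \<theta> (\<lambda>y. a * f y + b * g y)"
  using assms by (simp add: quasi_periodic_def algebra_simps)

lemma quasi_periodic_pin_op:
  assumes "quasi_periodic M \<theta> f"
  shows "quasi_periodic M \<theta> (pin_op \<delta> M f)"
  unfolding quasi_periodic_def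
proof
  fix y
  have *: "f (z + int M) = cis \<theta> * f z" for z
    using assms by (simp add: quasi_periodic_def)
  have "f (y + int M + 1) = cis \<theta> * f (y + 1)" "f (y + int M - 1) = cis \<theta> * f (y - 1)"
    using *[of "y + 1"] *[of "y - 1"] by (simp_all add: algebra_simps)
  then show "pin_op \<delta> M f (y + int M) = cis \<theta> * pin_op \<delta> M f y"
    by (simp add: pin_op_def * algebra_simps)
qed

lemma sum_shift_period:
  fixes p :: "int \<Rightarrow> 'a :: ab_group_add"
  assumes "\<And>y. p (y + int M) = p y"
  shows "(\<Sum>i<M. p (int i + 1)) = (\<Sum>i<M. p (int i))"
proof -
  have "(\<Sum>i<M. p (int i + 1)) - (\<Sum>i<M. p (int i)) = (\<Sum>i<M. p (int (Suc i)) - p (int i))"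
    by (simp add: sum_subtractf add.commute)
  also have "\<dots> = p (int M) - p 0"
    using sum_lessThan_telescope[of "\<lambda>i. p (int i)" M] by simp
  also have "\<dots> = 0"
    using assms[of 0] by simp
  finally show ?thesis by simp
qed

lemma cis_mult_cnj_cancel: "cis \<theta> * a * (cnj (cis \<theta>) * b) = a * b"
proof -
  have "cis \<theta> * cnj (cis \<theta>) = 1" by (simp add: cis_cnj cis_mult)
  then show ?thesis by (metis (no_types, lifting) mult.assoc mult.commute mult.left_neutral)
qed

lemma sum_hop_swap:
  assumes "quasi_periodic M \<theta> f" "quasi_periodic M \<theta> g"
  shows "(\<Sum>i<M. f (int i + 1) * cnj (g (int i))) = (\<Sum>i<M. f (int i) * cnj (g (int i - 1)))"
proof -
  have f: "f (z + int M) = cis \<theta> * f z" and g: "g (z + int M) = cis \<theta> * g z" for z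
    using assms by (simp_all add: quasi_periodic_def)
  have g': "g (y + int M - 1) = cis \<theta> * g (y - 1)" for y
    using g[of "y - 1"] by (simp add: algebra_simps)
  show ?thesis
    using sum_shift_period[of "\<lambda>y. f y * cnj (g (y - 1))" M]
    by (simp add: f g' cis_mult_cnj_cancel)
qed

lemma pin_inner_op_left:
  "pin_inner \<delta> M (pin_op \<delta> M f) g =
     ((\<Sum>i<M. f (int i + 1) * cnj (g (int i))) + 2 * (\<Sum>i<M. f (int i) * cnj (g (int i)))
       + (\<Sum>i<M. f (int i - 1) * cnj (g (int i)))) / 4"
  unfolding pin_inner_def pin_op_def sum_distrib_left sum.distrib[symmetric] sum_divide_distrib
  by (intro sum.cong) (auto simp: field_simps)

lemma pin_inner_op_right:
  "pin_inner \<delta> M f (pin_op \<delta> M g) =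
     ((\<Sum>i<M. f (int i) * cnj (g (int i + 1))) + 2 * (\<Sum>i<M. f (int i) * cnj (g (int i)))
       + (\<Sum>i<M. f (int i) * cnj (g (int i - 1)))) / 4"
  unfolding pin_inner_def pin_op_def sum_distrib_left sum.distrib[symmetric] sum_divide_distrib
  by (intro sum.cong) (auto simp: field_simps)

lemma sum_hop_swap':
  assumes "quasi_periodic M \<theta> f" "quasi_periodic M \<theta> g"
  shows "(\<Sum>i<M. f (int i - 1) * cnj (g (int i))) = (\<Sum>i<M. f (int i) * cnj (g (int i + 1)))"
  using arg_cong[OF sum_hop_swap[OF assms(2,1)], of cnj] by (simp add: mult.commute)

lemma pin_op_selfadjoint:
  assumes "quasi_periodic M \<theta> f" "quasi_periodic M \<theta> g"
  shows "pin_inner \<delta> M (pin_op \<delta> M f) g = pin_inner \<delta> M f (pin_op \<delta> M g)"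
  unfolding pin_inner_op_left pin_inner_op_right
  using sum_hop_swap[OF assms] sum_hop_swap'[OF assms] by simp

lemma sum_cmod_shift:
  assumes "quasi_periodic M \<theta> f"
  shows "(\<Sum>i<M. (cmod (f (int i + 1)))\<^sup>2) = (\<Sum>i<M. (cmod (f (int i)))\<^sup>2)"
  using assms by (intro sum_shift_period[of "\<lambda>y. (cmod (f y))\<^sup>2"])
    (simp add: quasi_periodic_def norm_mult)

lemma pin_inner_op_self:
  assumes "quasi_periodic M \<theta> f"
  shows "pin_inner \<delta> M (pin_op \<delta> M f) f = of_real (pin_form M f)"
proof -
  have "of_real (pin_form M f) = (\<Sum>i<M. (f (int i + 1) * cnj (f (int i)) + f (int i) * cnj (f (int i + 1))
      + of_real ((cmod (f (int i)))\<^sup>2) + of_real ((cmod (f (int i + 1)))\<^sup>2)) / 4)"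
    unfolding pin_form_def of_real_sum
    by (intro sum.cong) (auto simp: complex_norm_square algebra_simps simp del: of_real_power)
  also have "\<dots> = ((\<Sum>i<M. f (int i + 1) * cnj (f (int i))) + (\<Sum>i<M. f (int i) * cnj (f (int i + 1)))
      + of_real (\<Sum>i<M. (cmod (f (int i)))\<^sup>2) + of_real (\<Sum>i<M. (cmod (f (int i + 1)))\<^sup>2)) / 4"
    unfolding of_real_sum sum.distrib[symmetric] sum_divide_distrib ..
  also have "\<dots> = pin_inner \<delta> M (pin_op \<delta> M f) f"
    unfolding sum_cmod_shift[OF assms] pin_inner_op_left sum_hop_swap'[OF assms assms]
    by (simp add: complex_norm_square[symmetric])
  finally show ?thesis by simp
qed

lemma pin_form_le_norm2_of_zero:
  assumes "quasi_periodic M \<theta> f" "f 0 = 0"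
  shows "pin_form M f \<le> pin_norm2 \<delta> M f"
proof -
  have par: "(cmod (a + b))\<^sup>2 / 4 \<le> ((cmod a)\<^sup>2 + (cmod b)\<^sup>2) / 2" for a b :: complex
  proof -
    have "(cmod (a + b))\<^sup>2 \<le> (cmod a + cmod b)\<^sup>2"
      by (intro power_mono norm_triangle_ineq) auto
    also have "\<dots> \<le> 2 * ((cmod a)\<^sup>2 + (cmod b)\<^sup>2)"
      using sum_squares_bound[of "cmod a" "cmod b"] by (simp add: power2_sum)
    finally show ?thesis by simp
  qed
  have "pin_form M f \<le> (\<Sum>i<M. ((cmod (f (int i)))\<^sup>2 + (cmod (f (int i + 1)))\<^sup>2) / 2)"
    unfolding pin_form_def by (intro sum_mono par)
  also have "\<dots> = (\<Sum>i<M. (cmod (f (int i)))\<^sup>2)"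
    unfolding sum_divide_distrib[symmetric] sum.distrib sum_cmod_shift[OF assms(1)] by simp
  also have "\<dots> = pin_norm2 \<delta> M f"
    unfolding pin_norm2_def
    by (intro sum.cong) (use assms(2) in \<open>auto simp: pin_weight_def dest: zdvd_imp_le\<close>)
  finally show ?thesis .
qed

locale pinned_eigenfunction =
  fixes \<delta> :: real and M :: nat and \<theta> :: real and F :: "int \<Rightarrow> complex" and \<mu> :: real
  assumes M_pos: "M > 0"
    and F_qp: "quasi_periodic M \<theta> F"
    and F_eigen: "pin_op \<delta> M F = (\<lambda>y. of_real \<mu> * F y)"
    and \<mu>_ge1: "\<mu> \<ge> 1"
    and F_0: "F 0 = 1"
begin

lemma orth_pin_op:
  assumes R: "quasi_periodic M \<theta> R" and orth: "pin_inner \<delta> M R F = 0"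
  shows "pin_inner \<delta> M (pin_op \<delta> M R) F = 0"
  using pin_inner_lincomb_right[of \<delta> M R "of_real \<mu>" F 0 F] orth
  by (simp add: pin_op_selfadjoint[OF R F_qp] F_eigen)

text \<open>The pinning acts at one site per period only, so the form is bounded by the norm on a
  subspace of codimension one; the eigenfunction with \<open>\<mu> \<ge> 1\<close> uses up the missing dimension.\<close>

lemma pin_form_le_norm2:
  assumes R: "quasi_periodic M \<theta> R" and orth: "pin_inner \<delta> M R F = 0"
  shows "pin_form M R \<le> pin_norm2 \<delta> M R"
proof -
  define f where "f = (\<lambda>y. 1 * R y + (- R 0) * F y)"
  have qf: "quasi_periodic M \<theta> f"
    unfolding f_def by (intro quasi_periodic_lincomb R F_qp)
  have orth': "pin_inner \<delta> M F R = 0"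
    using cnj_pin_inner[of \<delta> M R F] orth by simp
  have GRF: "pin_inner \<delta> M (pin_op \<delta> M R) F = 0"
    by (rule orth_pin_op[OF R orth])
  have GF: "pin_inner \<delta> M (pin_op \<delta> M F) h = of_real \<mu> * pin_inner \<delta> M F h" for h
    using pin_inner_lincomb_left[of \<delta> M "of_real \<mu>" F 0 F h] by (simp add: F_eigen)
  have "complex_of_real (pin_form M f) = pin_inner \<delta> M (pin_op \<delta> M f) f"
    using pin_inner_op_self[OF qf] by simp
  also have "\<dots> = of_real (pin_form M R + \<mu> * (cmod (R 0))\<^sup>2 * pin_norm2 \<delta> M F)"
    unfolding f_def pin_op_lincomb pin_inner_lincomb_left pin_inner_lincomb_right GF GRF orth'
      pin_inner_op_self[OF R] pin_inner_self
    by (simp add: complex_norm_square del: of_real_power)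
  finally have 1: "pin_form M f = pin_form M R + \<mu> * (cmod (R 0))\<^sup>2 * pin_norm2 \<delta> M F"
    using of_real_eq_iff by blast
  have "complex_of_real (pin_norm2 \<delta> M f) = pin_inner \<delta> M f f"
    by (simp add: pin_inner_self)
  also have "\<dots> = of_real (pin_norm2 \<delta> M R + (cmod (R 0))\<^sup>2 * pin_norm2 \<delta> M F)"
    unfolding f_def pin_inner_lincomb_left pin_inner_lincomb_right orth orth' pin_inner_self
    by (simp add: complex_norm_square del: of_real_power)
  finally have 2: "pin_norm2 \<delta> M f = pin_norm2 \<delta> M R + (cmod (R 0))\<^sup>2 * pin_norm2 \<delta> M F"
    using of_real_eq_iff by blast
  have "pin_form M f \<le> pin_norm2 \<delta> M f"
    by (rule pin_form_le_norm2_of_zero[OF qf]) (simp add: f_def F_0)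
  moreover have "1 * ((cmod (R 0))\<^sup>2 * pin_norm2 \<delta> M F) \<le> \<mu> * ((cmod (R 0))\<^sup>2 * pin_norm2 \<delta> M F)"
    by (intro mult_right_mono \<mu>_ge1 mult_nonneg_nonneg pin_norm2_nonneg) auto
  ultimately show ?thesis unfolding 1 2 by (simp add: mult.assoc)
qed

text \<open>Positivity of the form at \<open>R - G R\<close> turns the form bound into a norm bound.\<close>

lemma pin_norm2_op_le:
  assumes R: "quasi_periodic M \<theta> R" and orth: "pin_inner \<delta> M R F = 0"
  shows "pin_norm2 \<delta> M (pin_op \<delta> M R) \<le> pin_norm2 \<delta> M R"
proof -
  let ?G = "pin_op \<delta> M"
  define f where "f = (\<lambda>y. 1 * R y + (- 1) * ?G R y)"
  have qG: "quasi_periodic M \<theta> (?G R)" by (rule quasi_periodic_pin_op[OF R])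
  have qf: "quasi_periodic M \<theta> f"
    unfolding f_def by (intro quasi_periodic_lincomb R qG)
  have GG: "pin_inner \<delta> M (?G (?G R)) R = pin_inner \<delta> M (?G R) (?G R)"
    by (rule pin_op_selfadjoint[OF qG R])
  have "complex_of_real (pin_form M f) = pin_inner \<delta> M (?G f) f"
    using pin_inner_op_self[OF qf] by simp
  also have "\<dots> = of_real (pin_form M R - 2 * pin_norm2 \<delta> M (?G R) + pin_form M (?G R))"
    unfolding f_def pin_op_lincomb pin_inner_lincomb_left pin_inner_lincomb_right GG
      pin_inner_op_self[OF R] pin_inner_op_self[OF qG] pin_inner_self by simp
  finally have "pin_form M f = pin_form M R - 2 * pin_norm2 \<delta> M (?G R) + pin_form M (?G R)"
    using of_real_eq_iff by blast
  with pin_form_nonneg[of M f] pin_form_le_norm2[OF R orth]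
    pin_form_le_norm2[OF qG orth_pin_op[OF R orth]]
  show ?thesis by linarith
qed

lemma iterate_orth:
  assumes R: "quasi_periodic M \<theta> R" and orth: "pin_inner \<delta> M R F = 0"
  shows "quasi_periodic M \<theta> ((pin_op \<delta> M ^^ k) R) \<and> pin_inner \<delta> M ((pin_op \<delta> M ^^ k) R) F = 0 \<and>
     pin_norm2 \<delta> M ((pin_op \<delta> M ^^ k) R) \<le> pin_norm2 \<delta> M R"
proof (induction k)
  case (Suc k)
  then show ?case
    using quasi_periodic_pin_op orth_pin_op pin_norm2_op_le by (fastforce intro: order_trans)
qed (use assms in auto)

lemma iterate_pin_op_at_0:
  assumes W: "quasi_periodic M \<theta> W"
  defines "a \<equiv> pin_inner \<delta> M W F / of_real (pin_norm2 \<delta> M F)"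
  shows "cmod ((pin_op \<delta> M ^^ k) W 0 - a * of_real (\<mu> ^ k)) \<le> sqrt (exp \<delta> * pin_norm2 \<delta> M W)"
proof -
  let ?G = "pin_op \<delta> M"
  define R where "R = (\<lambda>y. 1 * W y + (- a) * F y)"
  have qR: "quasi_periodic M \<theta> R"
    unfolding R_def by (intro quasi_periodic_lincomb W F_qp)
  have single: "(cmod (h 0))\<^sup>2 / exp \<delta> \<le> pin_norm2 \<delta> M h" for h
    unfolding pin_norm2_def using M_pos
    by (intro order_trans[OF _ member_le_sum[of 0]])
      (auto simp: pin_weight_def)
  have "pin_norm2 \<delta> M F > 0"
    using single[of F] F_0 by (smt (verit) divide_pos_pos exp_gt_zero norm_one power_one zero_less_one)
  then have nF: "complex_of_real (pin_norm2 \<delta> M F) \<noteq> 0" by simp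
  have orth: "pin_inner \<delta> M R F = 0"
    unfolding R_def pin_inner_lincomb_left pin_inner_self a_def using nF by simp
  have orth': "pin_inner \<delta> M F R = 0"
    using cnj_pin_inner[of \<delta> M R F] orth by simp
  have W_eq: "W = (\<lambda>y. 1 * R y + a * F y)"
    by (simp add: R_def)
  have iter: "(?G ^^ k) W = (\<lambda>y. 1 * (?G ^^ k) R y + (a * of_real (\<mu> ^ k)) * F y)"
  proof (induction k)
    case (Suc k)
    have "(?G ^^ Suc k) W = ?G (\<lambda>y. 1 * (?G ^^ k) R y + (a * of_real (\<mu> ^ k)) * F y)"
      using Suc by simp
    also have "\<dots> = (\<lambda>y. 1 * (?G ^^ Suc k) R y + (a * of_real (\<mu> ^ Suc k)) * F y)"
      unfolding pin_op_lincomb F_eigen by (simp add: mult_ac)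
    finally show ?case .
  qed (simp add: R_def)
  have "complex_of_real (pin_norm2 \<delta> M W) = pin_inner \<delta> M W W"
    by (simp add: pin_inner_self)
  also have "\<dots> = of_real (pin_norm2 \<delta> M R + (cmod a)\<^sup>2 * pin_norm2 \<delta> M F)"
    by (subst (1 2) W_eq) (simp only: pin_inner_lincomb_left pin_inner_lincomb_right orth orth' pin_inner_self,
      simp add: complex_norm_square del: of_real_power)
  finally have "pin_norm2 \<delta> M W = pin_norm2 \<delta> M R + (cmod a)\<^sup>2 * pin_norm2 \<delta> M F"
    using of_real_eq_iff by blast
  then have RW: "pin_norm2 \<delta> M R \<le> pin_norm2 \<delta> M W"
    using pin_norm2_nonneg[of \<delta> M F] by simp
  have "(cmod ((?G ^^ k) R 0))\<^sup>2 / exp \<delta> \<le> pin_norm2 \<delta> M W"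
    using single[of "(?G ^^ k) R"] iterate_orth[OF qR orth, of k] RW by linarith
  then have "(cmod ((?G ^^ k) R 0))\<^sup>2 \<le> exp \<delta> * pin_norm2 \<delta> M W"
    by (simp add: field_simps)
  then have "cmod ((?G ^^ k) R 0) \<le> sqrt (exp \<delta> * pin_norm2 \<delta> M W)"
    by (rule real_le_rsqrt)
  moreover have "(?G ^^ k) W 0 - a * of_real (\<mu> ^ k) = (?G ^^ k) R 0"
    by (subst iter) (simp add: F_0)
  ultimately show ?thesis by simp
qed

end

section \<open>The eigenfunction\<close>

definition sinh_ratio :: "nat \<Rightarrow> real \<Rightarrow> real \<Rightarrow> real" where
  "sinh_ratio M s x = sinh (2 * s * (real M - x)) / sinh (2 * s * real M)"

definition pin_eigenfun :: "nat \<Rightarrow> real \<Rightarrow> real \<Rightarrow> int \<Rightarrow> complex" where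
  "pin_eigenfun M \<theta> s y = cis (\<theta> * of_int (y div int M)) *
     (of_real (sinh_ratio M s (of_int (y mod int M)))
       + cis \<theta> * of_real (sinh_ratio M s (real M - of_int (y mod int M))))"

lemma quasi_periodic_eqI:
  assumes "M > 0" and f: "quasi_periodic M \<theta> f" and g: "quasi_periodic M \<theta> g"
    and eq: "\<And>y. 0 \<le> y \<Longrightarrow> y < int M \<Longrightarrow> f y = g y"
  shows "f = g"
proof
  fix y
  have shift: "h (y + int M * k) = cis (\<theta> * of_int k) * h y" if "quasi_periodic M \<theta> h" for h k y
  proof (induction k rule: int_induct[where k = 0])
    case (step1 i)
    have "h (y + int M * i + int M) = cis \<theta> * h (y + int M * i)"
      using that by (simp add: quasi_periodic_def)
    then show ?case using step1 by (simp add: algebra_simps cis_mult[symmetric])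
  next
    case (step2 i)
    have "h (y + int M * (i - 1) + int M) = cis \<theta> * h (y + int M * (i - 1))"
      using that unfolding quasi_periodic_def by blast
    then have "cis (\<theta> * of_int i) * h y = cis \<theta> * h (y + int M * (i - 1))"
      using step2 by (simp add: algebra_simps)
    then have "(cis (-\<theta>) * cis (\<theta> * of_int i)) * h y = (cis (-\<theta>) * cis \<theta>) * h (y + int M * (i - 1))"
      by (simp only: mult.assoc)
    then show ?case by (simp add: cis_mult right_diff_distrib)
  qed simp
  have "f (y mod int M) = g (y mod int M)"
    using \<open>M > 0\<close> by (intro eq) auto
  then show "f y = g y"
    using shift[OF f, of "y mod int M" "y div int M"] shift[OF g, of "y mod int M" "y div int M"]
    by simp
qed

context
  fixes M :: nat and s :: real
  assumes M: "M > 0" and s: "s > 0"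
begin

lemma sinh_pos: "sinh (2 * s * real M) > 0"
  unfolding sinh_real_pos_iff using M s by (intro mult_pos_pos) auto

lemma sinh_ratio_0: "sinh_ratio M s 0 = 1"
  using less_imp_neq[OF sinh_pos] by (simp add: sinh_ratio_def)

lemma sinh_ratio_M: "sinh_ratio M s (real M) = 0"
  by (simp add: sinh_ratio_def)

lemma sinh_ratio_nonneg: "x \<le> real M \<Longrightarrow> sinh_ratio M s x \<ge> 0"
  using sinh_pos s by (auto simp: sinh_ratio_def intro!: divide_nonneg_pos)

lemma sinh_ratio_le_exp:
  assumes "x \<ge> 0"
  shows "sinh_ratio M s x \<le> exp (- 2 * s * x)"
proof -
  have "exp (2 * s * x - 2 * s * real M) \<ge> exp (- (2 * s * x) - 2 * s * real M)"
    using assms s by simp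
  then have "sinh (2 * s * real M - 2 * s * x) \<le> exp (- (2 * s * x)) * sinh (2 * s * real M)"
    by (simp add: sinh_field_def exp_diff exp_minus exp_add field_simps)
  then show ?thesis
    using sinh_pos by (simp add: sinh_ratio_def field_simps)
qed

lemma sinh_ratio_recurrence:
  "sinh_ratio M s (x + 1) + 2 * sinh_ratio M s x + sinh_ratio M s (x - 1)
     = 4 * (cosh s)\<^sup>2 * sinh_ratio M s x"
proof -
  define a where "a = 2 * s * (real M - x)"
  have e: "2 * s * (real M - (x + 1)) = a - 2 * s" "2 * s * (real M - (x - 1)) = a + 2 * s"
    by (simp_all add: a_def algebra_simps)
  have c: "cosh (2 * s) = 2 * (cosh s)\<^sup>2 - 1"
    using cosh_double_cosh[of s] by simp
  have "sinh (a - 2 * s) + 2 * sinh a + sinh (a + 2 * s) = 4 * (cosh s)\<^sup>2 * sinh a"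
    unfolding sinh_add sinh_diff c by (simp add: algebra_simps)
  then show ?thesis
    unfolding sinh_ratio_def e a_def[symmetric] by (simp add: add_divide_distrib[symmetric])
qed

lemma pin_eigenfun_fundamental:
  assumes "0 \<le> y" "y \<le> int M"
  shows "pin_eigenfun M \<theta> s y = of_real (sinh_ratio M s (of_int y))
       + cis \<theta> * of_real (sinh_ratio M s (real M - of_int y))"
proof (cases "y = int M")
  case True
  then show ?thesis using M by (simp add: pin_eigenfun_def sinh_ratio_0 sinh_ratio_M)
next
  case False
  then show ?thesis using assms by (simp add: pin_eigenfun_def)
qed

lemma quasi_periodic_pin_eigenfun: "quasi_periodic M \<theta> (pin_eigenfun M \<theta> s)"
  using M by (auto simp: quasi_periodic_def pin_eigenfun_def algebra_simps cis_mult[symmetric])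

lemma pinned_eigenfunction_pin_eigenfun:
  assumes root: "(1 - exp (- \<delta>)) * sinh (2 * s * real M) = tanh s * (cosh (2 * s * real M) - cos \<theta>)"
  shows "pinned_eigenfunction \<delta> M \<theta> (pin_eigenfun M \<theta> s) ((cosh s)\<^sup>2)"
proof
  let ?F = "pin_eigenfun M \<theta> s" and ?A = "sinh_ratio M s"
  show "M > 0" by (rule M)
  show "quasi_periodic M \<theta> ?F" by (rule quasi_periodic_pin_eigenfun)
  show "(cosh s)\<^sup>2 \<ge> 1" by (simp add: cosh_real_ge_1)
  show F0: "?F 0 = 1"
    using pin_eigenfun_fundamental[of 0 \<theta>] by (simp add: sinh_ratio_0 sinh_ratio_M)
  show "pin_op \<delta> M ?F = (\<lambda>y. of_real ((cosh s)\<^sup>2) * ?F y)"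
  proof (rule quasi_periodic_eqI[OF M])
    show "quasi_periodic M \<theta> (pin_op \<delta> M ?F)"
      by (intro quasi_periodic_pin_op quasi_periodic_pin_eigenfun)
    show "quasi_periodic M \<theta> (\<lambda>y. of_real ((cosh s)\<^sup>2) * ?F y)"
      using quasi_periodic_lincomb[OF quasi_periodic_pin_eigenfun quasi_periodic_pin_eigenfun,
        of \<theta> "of_real ((cosh s)\<^sup>2)" 0] by simp
  next
    fix y assume y: "0 \<le> y" "y < int M"
    show "pin_op \<delta> M ?F y = of_real ((cosh s)\<^sup>2) * ?F y"
    proof (cases "y = 0")
      case False
      define x where "x = real_of_int y"
      have "\<not> int M dvd y" using y False by (auto dest: zdvd_imp_le)
      then have "pin_op \<delta> M ?F y = (?F (y + 1) + 2 * ?F y + ?F (y - 1)) / 4"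
        by (simp add: pin_op_def pin_weight_def)
      also have "\<dots> = (of_real (?A (x + 1) + 2 * ?A x + ?A (x - 1)) + cis \<theta> *
          of_real (?A (real M - x + 1) + 2 * ?A (real M - x) + ?A (real M - x - 1))) / 4"
        using y False by (simp add: pin_eigenfun_fundamental x_def algebra_simps)
      also have "\<dots> = of_real ((cosh s)\<^sup>2) * (of_real (?A x) + cis \<theta> * of_real (?A (real M - x)))"
        unfolding sinh_ratio_recurrence by (simp add: algebra_simps)
      also have "\<dots> = of_real ((cosh s)\<^sup>2) * ?F y"
        using y by (simp add: pin_eigenfun_fundamental x_def)
      finally show ?thesis .
    next
      case True
      have "?F (int M - 1) = cis \<theta> * ?F (-1)"
        using quasi_periodic_pin_eigenfun[of \<theta>, unfolded quasi_periodic_def, rule_format, of "-1"]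
        by simp
      then have "cis (-\<theta>) * ?F (int M - 1) = ?F (-1)"
        by (simp add: cis_mult mult.assoc[symmetric])
      moreover have "?F (int M - 1) = of_real (?A (real M - 1)) + cis \<theta> * of_real (?A 1)"
        using M by (simp add: pin_eigenfun_fundamental)
      ultimately have Fm: "?F (-1) = cis (-\<theta>) * of_real (?A (real M - 1)) + of_real (?A 1)"
        by (simp add: algebra_simps cis_mult) (metis cis_mult cis_zero mult.assoc mult.left_neutral right_minus)
      have F1: "?F 1 = of_real (?A 1) + cis \<theta> * of_real (?A (real M - 1))"
        using M by (simp add: pin_eigenfun_fundamental)
      have cs: "cis \<theta> + cis (-\<theta>) = of_real (2 * cos \<theta>)"
        by (simp add: complex_eq_iff)
      have "?F 1 + ?F (-1) = of_real (2 * ?A 1) + (cis \<theta> + cis (-\<theta>)) * of_real (?A (real M - 1))"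
        unfolding F1 Fm by (simp add: algebra_simps)
      then have sum: "?F 1 + ?F (-1) = of_real (2 * ?A 1 + 2 * cos \<theta> * ?A (real M - 1))"
        unfolding cs by simp
      define S where "S = sinh (2 * s * real M)"
      define C where "C = cosh (2 * s * real M)"
      have S: "S > 0" using sinh_pos by (simp add: S_def)
      have cs0: "cosh s > 0" by simp
      have A1: "?A 1 * S = S * (2 * (cosh s)\<^sup>2 - 1) - C * (2 * sinh s * cosh s)"
        using S by (simp add: sinh_ratio_def S_def[symmetric] right_diff_distrib sinh_diff C_def[symmetric]
           sinh_double cosh_double_cosh)
      have AM: "?A (real M - 1) * S = 2 * sinh s * cosh s"
        using S by (simp add: sinh_ratio_def S_def[symmetric] sinh_double)
      have "(1 - exp (- \<delta>)) * S * cosh s = sinh s * (C - cos \<theta>)"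
        using root cs0 by (simp add: S_def C_def tanh_def)
      then have "exp \<delta> * ((1 - exp (- \<delta>)) * S * cosh s) = exp \<delta> * (sinh s * (C - cos \<theta>))"
        by simp
      then have root': "exp \<delta> * (S * cosh s - sinh s * (C - cos \<theta>)) = S * cosh s"
        by (simp add: algebra_simps exp_minus)
      have "exp \<delta> * (2 * ?A 1 + 2 * cos \<theta> * ?A (real M - 1) + 2) * S
          = exp \<delta> * (2 * (?A 1 * S) + 2 * cos \<theta> * (?A (real M - 1) * S) + 2 * S)"
        by (simp add: algebra_simps)
      also have "\<dots> = 4 * cosh s * (exp \<delta> * (S * cosh s - sinh s * (C - cos \<theta>)))"
        unfolding A1 AM by (simp add: algebra_simps power2_eq_square)
      also have "\<dots> = 4 * (cosh s)\<^sup>2 * S"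
        unfolding root' by (simp add: power2_eq_square)
      finally have key: "exp \<delta> * (2 * ?A 1 + 2 * cos \<theta> * ?A (real M - 1) + 2) = 4 * (cosh s)\<^sup>2"
        using S by simp
      have "pin_op \<delta> M ?F 0 = of_real (exp \<delta>) * ((?F 1 + ?F (-1)) + 2) / 4"
        by (simp add: pin_op_def pin_weight_def F0 algebra_simps)
      also have "\<dots> = of_real (exp \<delta> * (2 * ?A 1 + 2 * cos \<theta> * ?A (real M - 1) + 2) / 4)"
        unfolding sum by simp
      also have "\<dots> = of_real ((cosh s)\<^sup>2) * ?F 0"
        unfolding key F0 by simp
      finally show ?thesis unfolding True .
    qed
  qed
qed

end

section \<open>From walks to the transfer operator\<close>

lemma walks_altdef: "walks N = {xs. set xs \<subseteq> {-1, 1} \<and> length xs = N}"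
  by (auto simp: walks_def)

lemma finite_walks [simp]: "finite (walks N)"
  unfolding walks_altdef by (rule finite_lists_length_eq) auto

lemma card_walks: "card (walks N) = 2 ^ N"
  unfolding walks_altdef by (subst card_lists_length_eq) (auto simp: numeral_2_eq_2)

lemma walks_nonempty [simp]: "walks N \<noteq> {}"
  using card_walks[of N] by force

lemma sum_walks_Suc:
  "(\<Sum>xs\<in>walks (Suc N). f xs) = (\<Sum>xs\<in>walks N. f (1 # xs)) + (\<Sum>xs\<in>walks N. f (-1 # xs))"
proof -
  have eq: "walks (Suc N) = (#) 1 ` walks N \<union> (#) (-1) ` walks N"
    by (auto simp: walks_def length_Suc_conv image_iff)
  show ?thesis
    unfolding eq by (subst sum.union_disjoint) (auto simp: sum.reindex)
qed

definition visits_from :: "nat \<Rightarrow> nat \<Rightarrow> int \<Rightarrow> int list \<Rightarrow> nat" where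
  "visits_from T N x xs = card {i \<in> {1..N}. int T dvd x + walk_pos xs i}"

lemma visits_from_Cons:
  "visits_from T (Suc N) x (e # xs) = (if int T dvd x + e then 1 else 0) + visits_from T N (x + e) xs"
proof -
  have split: "{i \<in> {1..Suc N}. int T dvd x + walk_pos (e # xs) i} =
      {i \<in> {1}. int T dvd x + e} \<union> Suc ` {i \<in> {1..N}. int T dvd x + e + walk_pos xs i}"
  proof (intro set_eqI)
    fix i
    show "i \<in> {i \<in> {1..Suc N}. int T dvd x + walk_pos (e # xs) i} \<longleftrightarrow>
      i \<in> {i \<in> {1}. int T dvd x + e} \<union> Suc ` {i \<in> {1..N}. int T dvd x + e + walk_pos xs i}"
      by (cases i; cases "i = 1") (auto simp: walk_pos_def add.assoc image_iff)
  qed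
  show ?thesis
    unfolding visits_from_def split by (subst card_Un_disjoint) (auto simp: card_image)
qed

definition twisted_partition :: "real \<Rightarrow> nat \<Rightarrow> real \<Rightarrow> nat \<Rightarrow> int \<Rightarrow> complex" where
  "twisted_partition \<delta> T u N x = (\<Sum>xs\<in>walks N.
     of_real (exp (\<delta> * real (visits_from T N x xs))) * cis (u * of_int (x + walk_pos xs N))) / 2 ^ N"

lemma twisted_partition_0: "twisted_partition \<delta> T u 0 x = cis (u * of_int x)"
proof -
  have "walks 0 = {[]}" by (auto simp: walks_def)
  then show ?thesis by (simp add: twisted_partition_def visits_from_def walk_pos_def)
qed

lemma twisted_partition_Suc:
  "twisted_partition \<delta> T u (Suc N) x =
     (of_real (pin_weight \<delta> T (x + 1)) * twisted_partition \<delta> T u N (x + 1)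
      + of_real (pin_weight \<delta> T (x - 1)) * twisted_partition \<delta> T u N (x - 1)) / 2"
proof -
  define f where "f = (\<lambda>y xs. complex_of_real (exp (\<delta> * real (visits_from T N y xs)))
    * cis (u * of_int (y + walk_pos xs N)))"
  have step: "complex_of_real (exp (\<delta> * real (visits_from T (Suc N) x (e # xs))))
      * cis (u * of_int (x + walk_pos (e # xs) (Suc N))) = of_real (pin_weight \<delta> T (x + e)) * f (x + e) xs"
    for e xs
    by (simp add: f_def visits_from_Cons pin_weight_def walk_pos_def add.assoc distrib_left exp_add)
  have 1: "twisted_partition \<delta> T u (Suc N) x =
      (of_real (pin_weight \<delta> T (x + 1)) * (\<Sum>xs\<in>walks N. f (x + 1) xs) +
       of_real (pin_weight \<delta> T (x + - 1)) * (\<Sum>xs\<in>walks N. f (x + - 1) xs)) / 2 ^ Suc N"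
    by (simp only: twisted_partition_def sum_walks_Suc step sum_distrib_left)
  have 2: "twisted_partition \<delta> T u N y = (\<Sum>xs\<in>walks N. f y xs) / 2 ^ N" for y
    by (simp only: twisted_partition_def f_def)
  show ?thesis unfolding 1 2 by (simp add: add_divide_distrib mult.commute)
qed

lemma pin_weight_double: "pin_weight \<delta> (2 * M) (2 * y) = pin_weight \<delta> M y"
  by (simp add: pin_weight_def)

lemma pin_weight_odd:
  assumes "odd x"
  shows "pin_weight \<delta> (2 * M) x = 1"
  using assms by (auto simp: pin_weight_def)

lemma twisted_partition_two_steps:
  "twisted_partition \<delta> (2 * M) u (Suc (Suc N)) (2 * y) =
     (of_real (pin_weight \<delta> M (y + 1)) * twisted_partition \<delta> (2 * M) u N (2 * (y + 1))
      + 2 * (of_real (pin_weight \<delta> M y) * twisted_partition \<delta> (2 * M) u N (2 * y))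
      + of_real (pin_weight \<delta> M (y - 1)) * twisted_partition \<delta> (2 * M) u N (2 * (y - 1))) / 4"
proof -
  have e: "2 * y + 1 + 1 = 2 * (y + 1)" "2 * y + 1 - 1 = 2 * y" "2 * y - 1 + 1 = 2 * y"
    "2 * y - 1 - 1 = 2 * (y - 1)" by auto
  have o: "pin_weight \<delta> (2 * M) (2 * y + 1) = 1" "pin_weight \<delta> (2 * M) (2 * y - 1) = 1"
    by (simp_all add: pin_weight_odd)
  show ?thesis
    unfolding twisted_partition_Suc[of _ _ _ "Suc N"] twisted_partition_Suc[of _ _ _ N] e
      pin_weight_double o
    by (simp add: field_simps)
qed

lemma twisted_partition_odd:
  "twisted_partition \<delta> (2 * M) u (Suc (2 * k)) (2 * y) =
     of_real (cos u) * twisted_partition \<delta> (2 * M) u (2 * k) (2 * y)"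
proof (induction k arbitrary: y)
  case 0
  have o: "pin_weight \<delta> (2 * M) (2 * y + 1) = 1" "pin_weight \<delta> (2 * M) (2 * y - 1) = 1"
    by (simp_all add: pin_weight_odd)
  have cs: "cis u + cis (-u) = 2 * of_real (cos u)"
    by (simp add: complex_eq_iff)
  have "twisted_partition \<delta> (2 * M) u (Suc 0) (2 * y) =
      (cis (u * of_int (2 * y)) * cis u + cis (u * of_int (2 * y)) * cis (-u)) / 2"
    unfolding twisted_partition_Suc twisted_partition_0 o
    by (simp add: cis_mult algebra_simps)
  also have "\<dots> = of_real (cos u) * cis (u * of_int (2 * y))"
    unfolding distrib_left[symmetric] cs by simp
  finally show ?case by (simp add: twisted_partition_0)
next
  case (Suc k)
  have "2 * Suc k = Suc (Suc (2 * k))" by simp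
  then show ?case
    by (simp only: twisted_partition_two_steps Suc.IH) (simp add: field_simps)
qed

lemma twisted_partition_even:
  "of_real (pin_weight \<delta> M y) * twisted_partition \<delta> (2 * M) u (2 * k) (2 * y) =
     (pin_op \<delta> M ^^ k) (\<lambda>y. of_real (pin_weight \<delta> M y) * cis (2 * u * of_int y)) y"
proof (induction k arbitrary: y)
  case 0
  show ?case by (simp add: twisted_partition_0 mult_ac)
next
  case (Suc k)
  have "2 * Suc k = Suc (Suc (2 * k))" by simp
  then show ?case
    by (simp only: twisted_partition_two_steps Suc.IH funpow.simps o_apply pin_op_def
        times_divide_eq_right)
qed

lemma partition_fn_eq: "complex_of_real (partition_fn T N \<delta>) = twisted_partition \<delta> T 0 N 0"
  by (simp add: partition_fn_def srw_def integral_pmf_of_set card_walks twisted_partition_def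
      visits_def visits_from_def)

lemma partition_fn_pos: "partition_fn T N \<delta> > 0"
  unfolding partition_fn_def srw_def
  by (subst integral_pmf_of_set) (auto simp: card_walks intro!: divide_pos_pos sum_pos)

lemma integral_polymer:
  fixes f :: "int list \<Rightarrow> complex"
  shows "integral\<^sup>L (polymer T N \<delta>) f =
    (\<Sum>xs\<in>walks N. of_real (exp (\<delta> * real (visits T N xs))) * f xs) / 2 ^ N / of_real (partition_fn T N \<delta>)"
proof -
  have "integral\<^sup>L (polymer T N \<delta>) f =
      (\<integral>xs. (exp (\<delta> * real (visits T N xs)) / partition_fn T N \<delta>) *\<^sub>R f xs \<partial>srw N)"
    unfolding polymer_def srw_def using partition_fn_pos[of T N \<delta>]
    by (subst integral_density) auto
  also have "\<dots> = (\<Sum>xs\<in>walks N. pmf (pmf_of_set (walks N)) xs *\<^sub>R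
      ((exp (\<delta> * real (visits T N xs)) / partition_fn T N \<delta>) *\<^sub>R f xs))"
    unfolding srw_def by (rule integral_measure_pmf) auto
  also have "\<dots> = (\<Sum>xs\<in>walks N. of_real (exp (\<delta> * real (visits T N xs))) * f xs / 2 ^ N
      / of_real (partition_fn T N \<delta>))"
    by (intro sum.cong) (auto simp: card_walks scaleR_conv_of_real)
  finally show ?thesis by (simp add: sum_divide_distrib)
qed

lemma prob_space_polymer: "prob_space (polymer T N \<delta>)"
proof
  let ?g = "\<lambda>xs. exp (\<delta> * real (visits T N xs)) / partition_fn T N \<delta>"
  have Z: "partition_fn T N \<delta> > 0" by (rule partition_fn_pos)
  have "emeasure (polymer T N \<delta>) (space (polymer T N \<delta>)) = (\<integral>\<^sup>+ xs. ennreal (?g xs) \<partial>srw N)"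
    unfolding polymer_def srw_def by (subst emeasure_density) auto
  also have "\<dots> = ennreal (\<integral>xs. ?g xs \<partial>srw N)"
    unfolding srw_def using Z
    by (intro nn_integral_eq_integral integrable_measure_pmf_finite) auto
  also have "(\<integral>xs. ?g xs \<partial>srw N) = 1"
    using Z unfolding partition_fn_def by simp
  finally show "emeasure (polymer T N \<delta>) (space (polymer T N \<delta>)) = 1" by simp
qed

lemma sets_polymer [simp]: "sets (polymer T N \<delta>) = UNIV"
  by (simp add: polymer_def srw_def)

lemma measurable_polymer [measurable]: "f \<in> borel_measurable (polymer T N \<delta>)"
  by (simp add: measurable_def)

lemma char_polymer:
  "char (distr (polymer T N \<delta>) borel (\<lambda>xs. real_of_int (walk_pos xs N) / b)) t =
     twisted_partition \<delta> T (t / b) N 0 / twisted_partition \<delta> T 0 N 0"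
proof -
  have "char (distr (polymer T N \<delta>) borel (\<lambda>xs. real_of_int (walk_pos xs N) / b)) t =
      integral\<^sup>L (polymer T N \<delta>) (\<lambda>xs. iexp (t * (real_of_int (walk_pos xs N) / b)))"
    unfolding char_def by (subst integral_distr) auto
  also have "\<dots> = twisted_partition \<delta> T (t / b) N 0 / twisted_partition \<delta> T 0 N 0"
    unfolding integral_polymer partition_fn_eq
    by (subst (3) twisted_partition_def)
      (simp add: twisted_partition_def cis_conv_exp visits_def visits_from_def)
  finally show ?thesis .
qed

section \<open>Convergence of the amplitude\<close>

lemma tendsto_sum_lessThan_dominated:
  fixes a :: "nat \<Rightarrow> nat \<Rightarrow> 'a :: {real_normed_algebra, banach}"
  assumes lim: "\<And>k. (\<lambda>n. a n k) \<longlonglongrightarrow> b k"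
    and M: "filterlim M at_top sequentially"
    and bound: "eventually (\<lambda>n. \<forall>k < M n. norm (a n k) \<le> h k) sequentially"
    and h: "summable h" "\<And>k. h k \<ge> 0"
  shows "(\<lambda>n. \<Sum>k<M n. a n k) \<longlonglongrightarrow> suminf b"
proof -
  define a' where "a' = (\<lambda>k n. if k < M n then a n k else 0)"
  have "(\<lambda>n. suminf (\<lambda>k. a' k n)) \<longlonglongrightarrow> suminf b"
  proof (rule tannerys_theorem[where M = h, THEN conjunct2, THEN conjunct2])
    show "(\<lambda>n. a' k n) \<longlonglongrightarrow> b k" for k
    proof (rule Lim_transform_eventually[OF lim])
      show "eventually (\<lambda>n. a n k = a' k n) sequentially"
        using M[unfolded filterlim_at_top, rule_format, of "Suc k"]
        by eventually_elim (simp add: a'_def)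
    qed
    have "eventually (\<lambda>n. \<forall>k. norm (a' k n) \<le> h k) sequentially"
      using bound by eventually_elim (use h(2) in \<open>auto simp: a'_def\<close>)
    then show "\<forall>\<^sub>F (k, n) in at_top \<times>\<^sub>F sequentially. norm (a' k n) \<le> h k"
      unfolding eventually_prod_filter
      by (intro exI[of _ "\<lambda>_. True"] exI[of _ "\<lambda>n. \<forall>k. norm (a' k n) \<le> h k"]) auto
  qed (use h in auto)
  moreover have "suminf (\<lambda>k. a' k n) = (\<Sum>k<M n. a n k)" for n
    by (subst suminf_finite[of "{..<M n}"]) (auto simp: a'_def)
  ultimately show ?thesis by simp
qed

definition plane_wave :: "real \<Rightarrow> nat \<Rightarrow> real \<Rightarrow> int \<Rightarrow> complex" where
  "plane_wave \<delta> M v y = of_real (pin_weight \<delta> M y) * cis (v * of_int y)"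

definition pin_amplitude :: "real \<Rightarrow> nat \<Rightarrow> real \<Rightarrow> real \<Rightarrow> complex" where
  "pin_amplitude \<delta> M \<theta> s = pin_inner \<delta> M (plane_wave \<delta> M (\<theta> / real M)) (pin_eigenfun M \<theta> s)
     / of_real (pin_norm2 \<delta> M (pin_eigenfun M \<theta> s))"

lemma quasi_periodic_plane_wave:
  assumes "M > 0"
  shows "quasi_periodic M \<theta> (plane_wave \<delta> M (\<theta> / real M))"
  using assms by (auto simp: quasi_periodic_def plane_wave_def algebra_simps cis_mult add_divide_distrib)

lemma pin_norm2_plane_wave:
  assumes "\<delta> > 0"
  shows "pin_norm2 \<delta> M (plane_wave \<delta> M v) \<le> exp \<delta> * real M"
proof -
  have "pin_norm2 \<delta> M (plane_wave \<delta> M v) = (\<Sum>i<M. pin_weight \<delta> M (int i))"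
    unfolding pin_norm2_def plane_wave_def
    by (intro sum.cong) (auto simp: norm_mult power2_eq_square less_imp_le)
  also have "\<dots> \<le> (\<Sum>i<M. exp \<delta>)"
    by (intro sum_mono) (use assms in \<open>auto simp: pin_weight_def\<close>)
  finally show ?thesis by (simp add: mult.commute)
qed

lemma pin_inner_plane_wave_eigenfun:
  assumes M: "M > 0" and s: "s > 0"
  shows "pin_inner \<delta> M (plane_wave \<delta> M (\<theta> / real M)) (pin_eigenfun M \<theta> s) =
    (\<Sum>i<M. cis (\<theta> / real M * real i) * of_real (sinh_ratio M s (real i))) +
    (\<Sum>i<M. cis (- (\<theta> / real M * real (Suc i))) * of_real (sinh_ratio M s (real (Suc i))))"
proof -
  define g where "g = (\<lambda>i::nat. cis (\<theta> / real M * real i - \<theta>) * of_real (sinh_ratio M s (real M - real i)))"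
  have plane: "plane_wave \<delta> M v (int i) * z / of_real (pin_weight \<delta> M (int i)) = cis (v * real i) * z"
    for i v z by (simp add: plane_wave_def)
  have "pin_inner \<delta> M (plane_wave \<delta> M (\<theta> / real M)) (pin_eigenfun M \<theta> s) =
    (\<Sum>i<M. cis (\<theta> / real M * real i) * of_real (sinh_ratio M s (real i)) + g i)"
    unfolding pin_inner_def plane
    by (intro sum.cong)
      (auto simp: pin_eigenfun_fundamental[OF M s] g_def distrib_left cis_cnj mult.assoc[symmetric] cis_mult minus_divide_left)
  also have "\<dots> = (\<Sum>i<M. cis (\<theta> / real M * real i) * of_real (sinh_ratio M s (real i))) + (\<Sum>i<M. g (M - Suc i))"
    unfolding sum.distrib by (simp add: sum.nat_diff_reindex)
  also have "(\<Sum>i<M. g (M - Suc i)) =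
      (\<Sum>i<M. cis (- (\<theta> / real M * real (Suc i))) * of_real (sinh_ratio M s (real (Suc i))))"
    by (intro sum.cong) (use M in \<open>auto simp: g_def of_nat_diff right_diff_distrib diff_divide_distrib\<close>)
  finally show ?thesis .
qed

lemma cmod_add_cis_power2:
  "(cmod (of_real a + cis \<theta> * of_real b))\<^sup>2 = a\<^sup>2 + b\<^sup>2 + 2 * cos \<theta> * (a * b)"
proof -
  have "(cos \<theta>)\<^sup>2 * b\<^sup>2 + (sin \<theta>)\<^sup>2 * b\<^sup>2 = b\<^sup>2"
    unfolding distrib_right[symmetric] by simp
  then show ?thesis
    by (simp add: cmod_power2 power2_sum power_mult_distrib algebra_simps)
qed

lemma pin_norm2_eigenfun:
  assumes M: "M > 0" and s: "s > 0"
  shows "pin_norm2 \<delta> M (pin_eigenfun M \<theta> s) =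
    (\<Sum>i<M. (sinh_ratio M s (real i))\<^sup>2 / (if i = 0 then exp \<delta> else 1)) +
    (\<Sum>i<M. (sinh_ratio M s (real (Suc i)))\<^sup>2) +
    2 * cos \<theta> * (\<Sum>i<M. sinh_ratio M s (real i) * sinh_ratio M s (real M - real i))"
proof -
  define g where "g = (\<lambda>i::nat. (sinh_ratio M s (real M - real i))\<^sup>2)"
  have w: "pin_weight \<delta> M (int i) = (if i = 0 then exp \<delta> else 1)" if "i < M" for i
    using that by (auto simp: pin_weight_def dest: dvd_imp_le)
  have "pin_norm2 \<delta> M (pin_eigenfun M \<theta> s) =
     (\<Sum>i<M. (sinh_ratio M s (real i))\<^sup>2 / (if i = 0 then exp \<delta> else 1) + g i +
        2 * cos \<theta> * (sinh_ratio M s (real i) * sinh_ratio M s (real M - real i)))"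
    unfolding pin_norm2_def
    by (intro sum.cong)
      (auto simp: w pin_eigenfun_fundamental[OF M s] g_def cmod_add_cis_power2 sinh_ratio_M[OF M s])
  also have "\<dots> = (\<Sum>i<M. (sinh_ratio M s (real i))\<^sup>2 / (if i = 0 then exp \<delta> else 1)) +
    (\<Sum>i<M. g (M - Suc i)) +
    2 * cos \<theta> * (\<Sum>i<M. sinh_ratio M s (real i) * sinh_ratio M s (real M - real i))"
    unfolding sum.distrib sum_distrib_left by (simp add: sum.nat_diff_reindex)
  also have "(\<Sum>i<M. g (M - Suc i)) = (\<Sum>i<M. (sinh_ratio M s (real (Suc i)))\<^sup>2)"
    by (intro sum.cong) (auto simp: g_def of_nat_diff)
  finally show ?thesis .
qed

lemma sinh_ratio_exp:
  assumes M: "M > 0" and s: "s > 0"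
  shows "sinh_ratio M s x = (exp (- 2 * s * x) - exp (2 * s * x) * exp (- (4 * (s * real M))))
     / (1 - exp (- (4 * (s * real M))))"
proof -
  define E where "E = exp (2 * s * real M)"
  define X where "X = exp (2 * s * x)"
  have E: "E > 1" using sinh_pos[OF M s] by (simp add: E_def)
  have X: "X > 0" by (simp add: X_def)
  have "exp (- (4 * (s * real M))) = exp (- (2 * s * real M)) * exp (- (2 * s * real M))"
    by (simp add: exp_add[symmetric])
  then have e1: "exp (- (4 * (s * real M))) = inverse E * inverse E"
    by (simp add: E_def exp_minus)
  have e2: "exp (- 2 * s * x) = inverse X" by (simp add: X_def exp_minus[symmetric])
  have e3: "sinh_ratio M s x = (E / X - X / E) / (E - 1 / E)"
  proof -
    have "sinh (2 * s * real M) = (E - 1 / E) / 2"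
      by (simp add: sinh_field_def exp_minus E_def inverse_eq_divide)
    moreover have "sinh (2 * s * (real M - x)) = (E / X - X / E) / 2"
      by (simp add: sinh_field_def right_diff_distrib exp_diff E_def X_def)
    moreover have "a / 2 / (b / 2) = a / b" for a b :: real by simp
    ultimately show ?thesis by (simp only: sinh_ratio_def)
  qed
  have "E * E > 1" using E by (simp add: less_1_mult)
  then have nz: "E * E - 1 \<noteq> 0" by simp
  show ?thesis unfolding e1 e2 e3 X_def[symmetric] using E X nz
    by (simp add: divide_simps)
qed

definition amplitude_limit :: "real \<Rightarrow> real \<Rightarrow> real" where
  "amplitude_limit \<delta> c = ((\<Sum>k. exp (- 2 * c * real k)) + (\<Sum>k. exp (- 2 * c * real (Suc k)))) /
     ((\<Sum>k. (exp (- 2 * c * real k))\<^sup>2 / (if k = 0 then exp \<delta> else 1)) + (\<Sum>k. (exp (- 2 * c * real (Suc k)))\<^sup>2))"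

lemma summable_exp_mult:
  fixes a :: real
  assumes "a > 0"
  shows "summable (\<lambda>k. exp (- a * real k))"
proof -
  have "exp (- a * real k) = exp (- a) ^ k" for k
    by (simp add: exp_of_nat_mult[symmetric] mult.commute)
  then show ?thesis using assms by (simp add: summable_geometric)
qed

context
  fixes c \<delta> :: real
  assumes c: "c > 0" and \<delta>: "\<delta> > 0"
begin

lemma summable_amplitude_numerator:
  "summable (\<lambda>k. exp (- 2 * c * real k))" "summable (\<lambda>k. exp (- 2 * c * real (Suc k)))"
proof -
  show *: "summable (\<lambda>k. exp (- 2 * c * real k))"
    using summable_exp_mult[of "2 * c"] c by simp
  then show "summable (\<lambda>k. exp (- 2 * c * real (Suc k)))"
    by (subst summable_Suc_iff)
qed

lemma summable_amplitude_denominator: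
  "summable (\<lambda>k. (exp (- 2 * c * real k))\<^sup>2 / (if k = 0 then exp \<delta> else 1))"
  "summable (\<lambda>k. (exp (- 2 * c * real (Suc k)))\<^sup>2)"
proof -
  have sq: "(exp (- 2 * c * real k))\<^sup>2 \<le> exp (- 2 * c * real k)" for k
    using c by (simp add: exp_double[symmetric])
  show "summable (\<lambda>k. (exp (- 2 * c * real k))\<^sup>2 / (if k = 0 then exp \<delta> else 1))"
  proof (rule summable_comparison_test'[OF summable_amplitude_numerator(1), of 0])
    fix k
    have "(exp (- 2 * c * real k))\<^sup>2 / (if k = 0 then exp \<delta> else 1) \<le> (exp (- 2 * c * real k))\<^sup>2"
      using \<delta> by auto
    with sq[of k] show "norm ((exp (- 2 * c * real k))\<^sup>2 / (if k = 0 then exp \<delta> else 1))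
        \<le> exp (- 2 * c * real k)"
      by simp
  qed
  have "summable (\<lambda>k. (exp (- 2 * c * real k))\<^sup>2)"
    by (rule summable_comparison_test'[OF summable_amplitude_numerator(1), of 0]) (use sq in auto)
  then show "summable (\<lambda>k. (exp (- 2 * c * real (Suc k)))\<^sup>2)"
    by (subst summable_Suc_iff)
qed

lemma amplitude_limit_pos: "amplitude_limit \<delta> c > 0"
  unfolding amplitude_limit_def
  by (intro divide_pos_pos add_pos_pos suminf_pos summable_amplitude_numerator
      summable_amplitude_denominator) auto

end

context
  fixes c \<delta> :: real and M :: "nat \<Rightarrow> nat" and s \<theta> :: "nat \<Rightarrow> real"
  assumes c: "c > 0" and \<delta>: "\<delta> > 0"
    and M: "filterlim M at_top sequentially" and s: "s \<longlonglongrightarrow> c" and \<theta>: "\<theta> \<longlonglongrightarrow> 0"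
begin

lemma eventually_good: "eventually (\<lambda>n. M n > 0 \<and> s n > c / 2) sequentially"
  using M[unfolded filterlim_at_top, rule_format, of 1] order_tendstoD(1)[OF s, of "c / 2"] c
  by (auto elim: eventually_elim2)

lemma sinh_ratio_tendsto: "(\<lambda>n. sinh_ratio (M n) (s n) x) \<longlonglongrightarrow> exp (- 2 * c * x)"
proof -
  have "filterlim (\<lambda>n. s n * real (M n)) at_top sequentially"
    by (rule filterlim_tendsto_pos_mult_at_top[OF s c filterlim_compose[OF filterlim_real_sequentially M]])
  then have "filterlim (\<lambda>n. 4 * (s n * real (M n))) at_top sequentially"
    by (intro filterlim_tendsto_pos_mult_at_top[OF tendsto_const]) auto
  then have "filterlim (\<lambda>n. - (4 * (s n * real (M n)))) at_bot sequentially"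
    by (simp add: filterlim_uminus_at_bot)
  then have e: "(\<lambda>n. exp (- (4 * (s n * real (M n))))) \<longlonglongrightarrow> 0"
    by (rule filterlim_compose[OF exp_at_bot])
  have "(\<lambda>n. (exp (- 2 * s n * x) - exp (2 * s n * x) * exp (- (4 * (s n * real (M n)))))
     / (1 - exp (- (4 * (s n * real (M n)))))) \<longlonglongrightarrow> (exp (- 2 * c * x) - exp (2 * c * x) * 0) / (1 - 0)"
    by (intro tendsto_intros s e) auto
  then have "(\<lambda>n. (exp (- 2 * s n * x) - exp (2 * s n * x) * exp (- (4 * (s n * real (M n)))))
     / (1 - exp (- (4 * (s n * real (M n)))))) \<longlonglongrightarrow> exp (- 2 * c * x)" by simp
  moreover have "eventually (\<lambda>n. (exp (- 2 * s n * x) - exp (2 * s n * x) * exp (- (4 * (s n * real (M n)))))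
     / (1 - exp (- (4 * (s n * real (M n))))) = sinh_ratio (M n) (s n) x) sequentially"
    using eventually_good by eventually_elim (use c in \<open>simp add: sinh_ratio_exp\<close>)
  ultimately show ?thesis by (rule Lim_transform_eventually)
qed

lemma sinh_ratio_bound:
  assumes "0 < M n" "s n > c / 2" "0 \<le> x" "x \<le> real (M n)"
  shows "\<bar>sinh_ratio (M n) (s n) x\<bar> \<le> exp (- c * x)"
proof -
  have s0: "s n > 0" using assms c by simp
  have "c * x \<le> 2 * s n * x" using assms by (intro mult_right_mono) auto
  then have "exp (- 2 * s n * x) \<le> exp (- c * x)" by simp
  with sinh_ratio_le_exp[OF assms(1) s0 assms(3)] sinh_ratio_nonneg[OF assms(1) s0 assms(4)]
  show ?thesis by linarith
qed

lemma sinh_ratio_bound_1: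
  assumes "0 < M n" "s n > c / 2" "0 \<le> x" "x \<le> real (M n)"
  shows "\<bar>sinh_ratio (M n) (s n) x\<bar> \<le> 1"
  using sinh_ratio_bound[OF assms] c assms(3)
  by (smt (verit) exp_le_one_iff mult_minus_left mult_nonneg_nonneg)

lemma pin_amplitude_tendsto:
  "(\<lambda>n. pin_amplitude \<delta> (M n) (\<theta> n) (s n)) \<longlonglongrightarrow> of_real (amplitude_limit \<delta> c)"
proof -
  let ?A = "\<lambda>n x. sinh_ratio (M n) (s n) x"
  note sum1 = summable_exp_mult[OF c]
  have Mr: "filterlim (\<lambda>n. real (M n)) at_top sequentially"
    by (rule filterlim_compose[OF filterlim_real_sequentially M])
  have v: "(\<lambda>n. \<theta> n / real (M n)) \<longlonglongrightarrow> 0"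
    by (rule tendsto_divide_0[OF \<theta> filterlim_at_top_imp_at_infinity[OF Mr]])
  have cis_lim: "(\<lambda>n. cis (f n)) \<longlonglongrightarrow> 1" if "f \<longlonglongrightarrow> 0" for f :: "nat \<Rightarrow> real"
    using tendsto_Complex[OF tendsto_cos[OF that] tendsto_sin[OF that]]
    by (simp add: cis.ctr one_complex.ctr)
  have summand: "(\<lambda>n. cis (\<theta> n / real (M n) * y) * of_real (?A n x)) \<longlonglongrightarrow> of_real (exp (- 2 * c * x))"
    for x y :: real
    using tendsto_mult[OF cis_lim[OF tendsto_mult_left_zero[OF v]] tendsto_of_real[OF sinh_ratio_tendsto], of y x]
    by (simp del: of_real_exp)
  have N1: "(\<lambda>n. \<Sum>i<M n. cis (\<theta> n / real (M n) * real i) * of_real (?A n (real i)))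
      \<longlonglongrightarrow> (\<Sum>k. complex_of_real (exp (- 2 * c * real k)))"
  proof (rule tendsto_sum_lessThan_dominated[OF summand M _ sum1])
    show "\<forall>\<^sub>F n in sequentially. \<forall>k<M n. norm (cis (\<theta> n / real (M n) * real k) *
        complex_of_real (?A n (real k))) \<le> exp (- c * real k)"
      using eventually_good
    proof eventually_elim
      case (elim n)
      then show ?case using sinh_ratio_bound[of n] by (simp add: norm_mult)
    qed
  qed simp
  have N2: "(\<lambda>n. \<Sum>i<M n. cis (- (\<theta> n / real (M n) * real (Suc i))) * of_real (?A n (real (Suc i))))
      \<longlonglongrightarrow> (\<Sum>k. complex_of_real (exp (- 2 * c * real (Suc k))))"
  proof (rule tendsto_sum_lessThan_dominated[OF _ M _ sum1])
    show "(\<lambda>n. cis (- (\<theta> n / real (M n) * real (Suc k))) * of_real (?A n (real (Suc k))))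
        \<longlonglongrightarrow> complex_of_real (exp (- 2 * c * real (Suc k)))" for k
      using summand[of "- real (Suc k)" "real (Suc k)"] by (simp only: mult_minus_right)
    show "\<forall>\<^sub>F n in sequentially. \<forall>k<M n. norm (cis (- (\<theta> n / real (M n) * real (Suc k))) *
        complex_of_real (?A n (real (Suc k)))) \<le> exp (- c * real k)"
      using eventually_good
    proof eventually_elim
      case (elim n)
      have "\<bar>?A n (real (Suc k))\<bar> \<le> exp (- c * real k)" if "k < M n" for k
      proof -
        have "\<bar>?A n (real (Suc k))\<bar> \<le> exp (- c * real (Suc k))"
          using that elim by (intro sinh_ratio_bound) auto
        also have "\<dots> \<le> exp (- c * real k)" using c by simp
        finally show ?thesis .
      qed
      then show ?case by (simp add: norm_mult)
    qed
  qed simp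
  have D1: "(\<lambda>n. \<Sum>i<M n. (?A n (real i))\<^sup>2 / (if i = 0 then exp \<delta> else 1))
      \<longlonglongrightarrow> (\<Sum>k. (exp (- 2 * c * real k))\<^sup>2 / (if k = 0 then exp \<delta> else 1))"
  proof (rule tendsto_sum_lessThan_dominated[OF _ M _ sum1])
    show "(\<lambda>n. (?A n (real k))\<^sup>2 / (if k = 0 then exp \<delta> else 1))
        \<longlonglongrightarrow> (exp (- 2 * c * real k))\<^sup>2 / (if k = 0 then exp \<delta> else 1)" for k
      by (intro tendsto_intros sinh_ratio_tendsto) auto
    show "\<forall>\<^sub>F n in sequentially. \<forall>k<M n. norm ((?A n (real k))\<^sup>2 / (if k = 0 then exp \<delta> else 1))
        \<le> exp (- c * real k)"
      using eventually_good
    proof eventually_elim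
      case (elim n)
      show ?case
      proof (intro allI impI)
        fix k assume k: "k < M n"
        have "norm ((?A n (real k))\<^sup>2 / (if k = 0 then exp \<delta> else 1)) \<le> (?A n (real k))\<^sup>2"
          using \<delta> by (auto simp: divide_le_eq mult_le_cancel_left1)
        also have "\<dots> = \<bar>?A n (real k)\<bar> * \<bar>?A n (real k)\<bar>" by (simp add: power2_eq_square)
        also have "\<dots> \<le> exp (- c * real k) * 1"
          using k elim by (intro mult_mono sinh_ratio_bound sinh_ratio_bound_1) auto
        finally show "norm ((?A n (real k))\<^sup>2 / (if k = 0 then exp \<delta> else 1)) \<le> exp (- c * real k)"
          by simp
      qed
    qed
  qed simp
  have D2: "(\<lambda>n. \<Sum>i<M n. (?A n (real (Suc i)))\<^sup>2) \<longlonglongrightarrow> (\<Sum>k. (exp (- 2 * c * real (Suc k)))\<^sup>2)"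
  proof (rule tendsto_sum_lessThan_dominated[OF _ M _ sum1])
    show "(\<lambda>n. (?A n (real (Suc k)))\<^sup>2) \<longlonglongrightarrow> (exp (- 2 * c * real (Suc k)))\<^sup>2" for k
      by (intro tendsto_intros sinh_ratio_tendsto)
    show "\<forall>\<^sub>F n in sequentially. \<forall>k<M n. norm ((?A n (real (Suc k)))\<^sup>2) \<le> exp (- c * real k)"
      using eventually_good
    proof eventually_elim
      case (elim n)
      show ?case
      proof (intro allI impI)
        fix k assume k: "k < M n"
        have "norm ((?A n (real (Suc k)))\<^sup>2) = \<bar>?A n (real (Suc k))\<bar> * \<bar>?A n (real (Suc k))\<bar>"
          by (simp add: power2_eq_square abs_mult)
        also have "\<dots> \<le> exp (- c * real (Suc k)) * 1"
          using k elim by (intro mult_mono sinh_ratio_bound sinh_ratio_bound_1) auto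
        also have "\<dots> \<le> exp (- c * real k)" using c by simp
        finally show "norm ((?A n (real (Suc k)))\<^sup>2) \<le> exp (- c * real k)" .
      qed
    qed
  qed simp
  have D3: "(\<lambda>n. \<Sum>i<M n. ?A n (real i) * ?A n (real (M n) - real i)) \<longlonglongrightarrow> 0"
  proof (rule tendsto_0_le)
    have "((\<lambda>x. x * exp (- c * x)) \<longlongrightarrow> 0) at_top" using c by real_asymp
    from filterlim_compose[OF this Mr]
    show "(\<lambda>n. real (M n) * exp (- c * real (M n))) \<longlonglongrightarrow> 0" .
    show "\<forall>\<^sub>F n in sequentially. norm (\<Sum>i<M n. ?A n (real i) * ?A n (real (M n) - real i))
        \<le> norm (real (M n) * exp (- c * real (M n))) * 1"
      using eventually_good
    proof eventually_elim
      case (elim n)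
      have "norm (\<Sum>i<M n. ?A n (real i) * ?A n (real (M n) - real i)) \<le> (\<Sum>i<M n. exp (- c * real (M n)))"
      proof (rule sum_norm_le)
        fix i assume i: "i \<in> {..<M n}"
        have "norm (?A n (real i) * ?A n (real (M n) - real i)) =
            \<bar>?A n (real i)\<bar> * \<bar>?A n (real (M n) - real i)\<bar>" by (simp add: abs_mult)
        also have "\<dots> \<le> exp (- c * real i) * exp (- c * (real (M n) - real i))"
          using i elim by (intro mult_mono sinh_ratio_bound) auto
        also have "\<dots> = exp (- c * real (M n))"
          by (simp add: exp_add[symmetric] algebra_simps)
        finally show "norm (?A n (real i) * ?A n (real (M n) - real i)) \<le> exp (- c * real (M n))" .
      qed
      then show ?case by (simp add: abs_mult)
    qed
  qed
  define D where "D = (\<Sum>k. (exp (- 2 * c * real k))\<^sup>2 / (if k = 0 then exp \<delta> else 1))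
    + (\<Sum>k. (exp (- 2 * c * real (Suc k)))\<^sup>2)"
  have "D > 0"
    unfolding D_def
    by (intro add_pos_pos suminf_pos summable_amplitude_denominator[OF c \<delta>]) auto
  have "(\<lambda>n. of_real ((\<Sum>i<M n. (?A n (real i))\<^sup>2 / (if i = 0 then exp \<delta> else 1)) +
      (\<Sum>i<M n. (?A n (real (Suc i)))\<^sup>2) +
      2 * cos (\<theta> n) * (\<Sum>i<M n. ?A n (real i) * ?A n (real (M n) - real i))) :: complex)
      \<longlonglongrightarrow> of_real (D + 2 * cos 0 * 0)"
    unfolding D_def by (intro tendsto_intros D1 D2 D3 \<theta>)
  then have D_lim: "(\<lambda>n. of_real ((\<Sum>i<M n. (?A n (real i))\<^sup>2 / (if i = 0 then exp \<delta> else 1)) +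
      (\<Sum>i<M n. (?A n (real (Suc i)))\<^sup>2) +
      2 * cos (\<theta> n) * (\<Sum>i<M n. ?A n (real i) * ?A n (real (M n) - real i))) :: complex)
      \<longlonglongrightarrow> of_real D"
    by simp
  have lim: "of_real (amplitude_limit \<delta> c) = ((\<Sum>k. complex_of_real (exp (- 2 * c * real k)))
      + (\<Sum>k. complex_of_real (exp (- 2 * c * real (Suc k))))) / of_real D"
    unfolding amplitude_limit_def D_def[symmetric]
    using summable_amplitude_numerator[OF c \<delta>] by (simp only: of_real_divide of_real_add suminf_of_real)
  show ?thesis
    unfolding lim
  proof (rule Lim_transform_eventually[OF tendsto_divide[OF tendsto_add[OF N1 N2] D_lim]])
    show "complex_of_real D \<noteq> 0" using \<open>D > 0\<close> by simp
    show "\<forall>\<^sub>F n in sequentially. ((\<Sum>i<M n. cis (\<theta> n / real (M n) * real i) * of_real (?A n (real i))) +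
        (\<Sum>i<M n. cis (- (\<theta> n / real (M n) * real (Suc i))) * of_real (?A n (real (Suc i))))) /
        of_real ((\<Sum>i<M n. (?A n (real i))\<^sup>2 / (if i = 0 then exp \<delta> else 1)) +
      (\<Sum>i<M n. (?A n (real (Suc i)))\<^sup>2) +
      2 * cos (\<theta> n) * (\<Sum>i<M n. ?A n (real i) * ?A n (real (M n) - real i))) =
        pin_amplitude \<delta> (M n) (\<theta> n) (s n)"
      using eventually_good
    proof eventually_elim
      case (elim n)
      then have "M n > 0" "s n > 0" using c by auto
      then show ?case
        unfolding pin_amplitude_def by (simp only: pin_inner_plane_wave_eigenfun pin_norm2_eigenfun)
    qed
  qed
qed

end

section \<open>The eigenvalue equation\<close>

text \<open>The matching condition at the pinned site for a function solving \<open>f (x + 1) + f (x - 1) = 2 cosh s f x\<close>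
  elsewhere, with \<open>c = c_delta \<delta>\<close> and hence \<open>tanh c = 1 - exp (- \<delta>)\<close>; the bounds on \<open>s\<close> only serve to
  keep it away from \<open>0\<close> and infinity.\<close>

definition pin_root :: "real \<Rightarrow> real \<Rightarrow> real \<Rightarrow> real \<Rightarrow> bool" where
  "pin_root c T \<theta> s \<longleftrightarrow> c / 2 \<le> s \<and> s \<le> 2 * c \<and>
     tanh c * sinh (s * T) = tanh s * (cosh (s * T) - cos \<theta>)"

lemma pin_root_exists:
  assumes c: "c > 0"
  shows "eventually (\<lambda>T. \<forall>\<theta>. \<exists>s. pin_root c T \<theta> s) at_top"
proof -
  define a where "a = tanh c - tanh (c / 2)"
  define b where "b = tanh (2 * c) - tanh c"
  have ab: "a > 0" "b > 0"
    using c strict_monoD[OF tanh_real_strict_mono] by (auto simp: a_def b_def)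
  have lim: "filterlim (\<lambda>T. sinh (d * T)) at_top at_top" if "d > 0" for d :: real
    using that by (intro filterlim_compose[OF sinh_real_at_top]
        filterlim_tendsto_pos_mult_at_top[OF tendsto_const] filterlim_ident) auto
  have c2: "c / 2 > 0" "2 * c > 0" using c by auto
  have "eventually (\<lambda>T. sinh (c / 2 * T) > 2 / a) at_top" "eventually (\<lambda>T. sinh (2 * c * T) > 2 / b) at_top"
    using lim[OF c2(1)] lim[OF c2(2)] unfolding filterlim_at_top_dense by blast+
  then show ?thesis
    using eventually_gt_at_top[of 0]
  proof eventually_elim
    case (elim T)
    show ?case
    proof
      fix \<theta> :: real
      define h where "h = (\<lambda>s. tanh s * (cosh (s * T) - cos \<theta>) - tanh c * sinh (s * T))"
      have "\<exists>s. c / 2 \<le> s \<and> s \<le> 2 * c \<and> h s = 0"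
      proof (rule IVT')
        define S where "S = sinh (c / 2 * T)"
        have "cosh (c / 2 * T) - S = exp (- (c / 2 * T))"
          unfolding S_def by (rule cosh_minus_sinh)
        moreover have "exp (- (c / 2 * T)) \<le> 1" using c elim by simp
        ultimately have 1: "cosh (c / 2 * T) - cos \<theta> \<le> S + 2"
          using cos_ge_minus_one[of \<theta>] by linarith
        have 2: "tanh (c / 2) \<ge> 0" "tanh (c / 2) \<le> 1" using c tanh_real_lt_1[of "c / 2"] by auto
        have 3: "S * a > 2" using elim(1) ab by (simp add: S_def field_simps)
        have "tanh (c / 2) * (cosh (c / 2 * T) - cos \<theta>) \<le> tanh (c / 2) * (S + 2)"
          using 1 2 by (intro mult_left_mono)
        also have "\<dots> \<le> tanh (c / 2) * S + 2" using 2 by (simp add: distrib_left)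
        finally show "h (c / 2) \<le> 0"
          using 3 unfolding h_def a_def S_def[symmetric] by (simp add: algebra_simps)
      next
        define S where "S = sinh (2 * c * T)"
        have "cosh (2 * c * T) - S = exp (- (2 * c * T))"
          unfolding S_def by (rule cosh_minus_sinh)
        then have 1: "cosh (2 * c * T) - cos \<theta> \<ge> S - 1"
          using cos_le_one[of \<theta>] exp_gt_zero[of "- (2 * c * T)"] by linarith
        have 2: "tanh (2 * c) \<ge> 0" "tanh (2 * c) \<le> 1" using c tanh_real_lt_1[of "2 * c"] by auto
        have 3: "S * b > 2" using elim(2) ab by (simp add: S_def field_simps)
        have "tanh (2 * c) * S - 1 \<le> tanh (2 * c) * (S - 1)" using 2 by (simp add: right_diff_distrib)
        also have "\<dots> \<le> tanh (2 * c) * (cosh (2 * c * T) - cos \<theta>)"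
          using 1 2 by (intro mult_left_mono)
        finally show "0 \<le> h (2 * c)"
          using 3 unfolding h_def b_def S_def[symmetric] by (simp add: algebra_simps)
      next
        show "c / 2 \<le> 2 * c" using c by simp
        show "continuous_on {c / 2..2 * c} h"
          unfolding h_def by (intro continuous_intros) auto
      qed
      then show "\<exists>s. pin_root c T \<theta> s"
        unfolding pin_root_def h_def by auto
    qed
  qed
qed

lemma mvt_between:
  fixes f f' :: "real \<Rightarrow> real"
  assumes "\<And>x. (f has_real_derivative f' x) (at x)"
  shows "\<exists>\<xi>. min a b \<le> \<xi> \<and> \<xi> \<le> max a b \<and> f a - f b = (a - b) * f' \<xi>"
proof (cases a b rule: linorder_cases)
  case less
  from MVT2[OF less, of f f'] assms obtain z where "a < z" "z < b" "f b - f a = (b - a) * f' z"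
    by auto
  with less show ?thesis by (intro exI[of _ z]) (auto simp: algebra_simps)
next
  case greater
  from MVT2[OF greater, of f f'] assms obtain z where "b < z" "z < a" "f a - f b = (a - b) * f' z"
    by auto
  with greater show ?thesis by (intro exI[of _ z]) auto
qed auto

lemma has_derivative_tanh_real: "(tanh has_real_derivative 1 - (tanh x)\<^sup>2) (at (x::real))"
  by (auto intro!: derivative_eq_intros)

lemma pin_root_dist:
  assumes c: "c > 0" and T: "T > 0" and root: "pin_root c T \<theta> s"
  shows "\<bar>s - c\<bar> \<le> 2 / (1 - (tanh (2 * c))\<^sup>2) / sinh (c / 2 * T)"
proof -
  define \<kappa> where "\<kappa> = 1 - (tanh (2 * c))\<^sup>2"
  have "(tanh (2 * c))\<^sup>2 < 1\<^sup>2"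
    using c tanh_real_lt_1[of "2 * c"] by (intro power_strict_mono) auto
  then have \<kappa>: "\<kappa> > 0" by (simp add: \<kappa>_def)
  have s: "c / 2 \<le> s" "s \<le> 2 * c" and eq: "tanh c * sinh (s * T) = tanh s * (cosh (s * T) - cos \<theta>)"
    using root by (auto simp: pin_root_def)
  have s0: "s > 0" using s c by linarith
  have x: "c / 2 * T \<le> s * T" using s T by (intro mult_right_mono) auto
  have S0: "sinh (c / 2 * T) > 0" using c T by simp
  have S: "sinh (s * T) > 0" using s0 T by simp
  have "cosh (s * T) = sinh (s * T) + exp (- (s * T))"
    using cosh_minus_sinh[of "s * T"] by simp
  then have "(tanh c - tanh s) * sinh (s * T) = tanh s * (exp (- (s * T)) - cos \<theta>)"
    using eq by (simp add: algebra_simps)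
  then have "\<bar>tanh c - tanh s\<bar> * sinh (s * T) = \<bar>tanh s\<bar> * \<bar>exp (- (s * T)) - cos \<theta>\<bar>"
    using S by (metis abs_mult abs_of_pos)
  also have "\<dots> \<le> 1 * 2"
  proof (intro mult_mono)
    show "\<bar>tanh s\<bar> \<le> 1" using tanh_real_lt_1[of s] s0 by simp
    have "exp (- (s * T)) \<le> 1" using s0 T by simp
    then show "\<bar>exp (- (s * T)) - cos \<theta>\<bar> \<le> 2"
      using cos_ge_minus_one[of \<theta>] cos_le_one[of \<theta>] exp_gt_zero[of "- (s * T)"] by linarith
  qed auto
  finally have "\<bar>tanh c - tanh s\<bar> * sinh (s * T) \<le> 2" by simp
  moreover have "\<bar>tanh c - tanh s\<bar> * sinh (c / 2 * T) \<le> \<bar>tanh c - tanh s\<bar> * sinh (s * T)"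
    using x by (intro mult_left_mono) auto
  ultimately have A: "\<bar>tanh c - tanh s\<bar> * sinh (c / 2 * T) \<le> 2" by linarith
  obtain \<xi> where \<xi>: "min s c \<le> \<xi>" "\<xi> \<le> max s c" "tanh s - tanh c = (s - c) * (1 - (tanh \<xi>)\<^sup>2)"
    using mvt_between[OF has_derivative_tanh_real] by blast
  have "0 \<le> \<xi>" "\<xi> \<le> 2 * c" using \<xi> s c by (auto simp: min_def max_def split: if_splits)
  then have "(tanh \<xi>)\<^sup>2 \<le> (tanh (2 * c))\<^sup>2"
    by (intro power_mono) auto
  then have "\<kappa> \<le> 1 - (tanh \<xi>)\<^sup>2" by (simp add: \<kappa>_def)
  then have "\<bar>s - c\<bar> * \<kappa> \<le> \<bar>s - c\<bar> * (1 - (tanh \<xi>)\<^sup>2)" by (intro mult_left_mono) auto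
  also have "\<dots> = \<bar>tanh c - tanh s\<bar>"
    using \<open>\<kappa> \<le> _\<close> \<kappa> by (subst abs_minus_commute, subst \<xi>(3)) (simp add: abs_mult)
  finally have "\<bar>s - c\<bar> * \<kappa> * sinh (c / 2 * T) \<le> \<bar>tanh c - tanh s\<bar> * sinh (c / 2 * T)"
    using S0 by (intro mult_right_mono) auto
  with A have "\<bar>s - c\<bar> * \<kappa> * sinh (c / 2 * T) \<le> 2" by linarith
  then show ?thesis
    unfolding \<kappa>_def[symmetric] using \<kappa> S0 by (simp add: pos_le_divide_eq mult_ac)
qed

lemma has_derivative_tanh_mult:
  "((\<lambda>x. tanh x * tanh (x * T / 2)) has_real_derivative
     ((1 - (tanh x)\<^sup>2) * tanh (x * T / 2) + tanh x * ((1 - (tanh (x * T / 2))\<^sup>2) * (T / 2)))) (at (x::real))"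
  by (auto intro!: derivative_eq_intros simp: algebra_simps)

lemma has_derivative_ln_cosh: "((\<lambda>x. ln (cosh x)) has_real_derivative tanh x) (at (x::real))"
  by (auto intro!: derivative_eq_intros simp: tanh_def)

lemma cosh_power2_mult_tanh: "(cosh x)\<^sup>2 * (1 - (tanh x)\<^sup>2) = (1 :: real)"
proof -
  have "tanh x * cosh x = sinh x" by (simp add: tanh_def)
  then have "(cosh x)\<^sup>2 * (1 - (tanh x)\<^sup>2) = (cosh x)\<^sup>2 - (sinh x)\<^sup>2"
    by (simp add: right_diff_distrib power_mult_distrib[symmetric] mult.commute)
  then show ?thesis using cosh_square_eq[of x] by simp
qed

lemma cosh_minus_1_div_sinh:
  fixes x :: real
  assumes "x > 0"
  shows "(cosh x - 1) / sinh x = tanh (x / 2)"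
proof -
  have c: "cosh x = 2 * (sinh (x / 2))\<^sup>2 + 1"
    using cosh_double[of "x / 2"] cosh_square_eq[of "x / 2"] by simp
  have s: "sinh x = 2 * sinh (x / 2) * cosh (x / 2)"
    using sinh_double[of "x / 2"] by simp
  have "sinh (x / 2) > 0" using assms by simp
  then show ?thesis unfolding c s by (simp add: tanh_def power2_eq_square)
qed

context
  fixes c :: real and T :: "nat \<Rightarrow> real"
  assumes c: "c > 0" and T: "filterlim T at_top sequentially"
begin

lemma eventually_T_pos: "eventually (\<lambda>n. T n > 0) sequentially"
  using T by (simp add: filterlim_at_top_dense)

lemma pin_root_scaled_tendsto:
  assumes root: "eventually (\<lambda>n. pin_root c (T n) (\<theta> n) (s n)) sequentially"
  shows "(\<lambda>n. T n * (s n - c)) \<longlonglongrightarrow> 0"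
proof (rule tendsto_0_le)
  have "((\<lambda>x. x / sinh (c / 2 * x)) \<longlongrightarrow> 0) at_top"
    unfolding sinh_field_def using c by real_asymp
  from filterlim_compose[OF this T]
  show "(\<lambda>n. T n / sinh (c / 2 * T n)) \<longlonglongrightarrow> 0" .
  show "\<forall>\<^sub>F n in sequentially. norm (T n * (s n - c)) \<le>
      norm (T n / sinh (c / 2 * T n)) * (2 / (1 - (tanh (2 * c))\<^sup>2))"
    using root eventually_T_pos
  proof eventually_elim
    case (elim n)
    have "T n * \<bar>s n - c\<bar> \<le> T n * (2 / (1 - (tanh (2 * c))\<^sup>2) / sinh (c / 2 * T n))"
      using pin_root_dist[OF c elim(2,1)] elim(2) by (intro mult_left_mono) auto
    moreover have "sinh (c / 2 * T n) > 0" using c elim by simp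
    ultimately show ?case using elim(2) by (simp add: abs_mult mult_ac)
  qed
qed

lemma pin_root_tendsto:
  assumes root: "eventually (\<lambda>n. pin_root c (T n) (\<theta> n) (s n)) sequentially"
  shows "s \<longlonglongrightarrow> c"
proof -
  have "(\<lambda>n. T n * (s n - c) / T n) \<longlonglongrightarrow> 0"
    by (rule tendsto_divide_0[OF pin_root_scaled_tendsto[OF root] filterlim_at_top_imp_at_infinity[OF T]])
  then have "(\<lambda>n. s n - c) \<longlonglongrightarrow> 0"
    by (rule Lim_transform_eventually) (use eventually_T_pos in \<open>auto elim!: eventually_mono\<close>)
  then show ?thesis by (simp add: LIM_zero_iff)
qed

lemma sinh_pin_root_tendsto:
  assumes root: "eventually (\<lambda>n. pin_root c (T n) (\<theta> n) (s n)) sequentially"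
  shows "(\<lambda>n. exp (- c * T n) * sinh (s n * T n)) \<longlonglongrightarrow> 1 / 2"
proof -
  have e: "((\<lambda>x. exp (- 2 * c * x)) \<longlongrightarrow> 0) at_top" using c by real_asymp
  have "(\<lambda>n. (exp (T n * (s n - c)) - exp (- (T n * (s n - c))) * exp (- 2 * c * T n)) / 2)
      \<longlonglongrightarrow> (exp 0 - exp (- 0) * 0) / 2"
    by (intro tendsto_intros pin_root_scaled_tendsto[OF root] filterlim_compose[OF e T]) auto
  moreover have "(exp (x * (y - c)) - exp (- (x * (y - c))) * exp (- 2 * c * x)) / 2
      = exp (- c * x) * sinh (y * x)" for x y
    by (simp add: sinh_field_def exp_add[symmetric] algebra_simps right_diff_distrib)
  ultimately show ?thesis by simp
qed

lemma log_eigenvalue_gap_tendsto: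
  assumes root: "eventually (\<lambda>n. pin_root c (T n) (\<theta> n) (s n)) sequentially"
    and root0: "eventually (\<lambda>n. pin_root c (T n) 0 (r n)) sequentially"
    and q: "(\<lambda>n. L n * (1 - cos (\<theta> n)) * exp (- c * T n)) \<longlonglongrightarrow> q"
  shows "(\<lambda>n. L n * (ln (cosh (s n)) - ln (cosh (r n)))) \<longlonglongrightarrow> - (2 * q * (sinh c)\<^sup>2)"
proof -
  let ?\<Phi> = "\<lambda>n x. tanh x * tanh (x * T n / 2)"
  let ?\<Phi>' = "\<lambda>n x. (1 - (tanh x)\<^sup>2) * tanh (x * T n / 2) + tanh x * ((1 - (tanh (x * T n / 2))\<^sup>2) * (T n / 2))"
  note sc = pin_root_tendsto[OF root] and rc = pin_root_tendsto[OF root0]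
  have "\<forall>n. \<exists>\<xi>. min (r n) (s n) \<le> \<xi> \<and> \<xi> \<le> max (r n) (s n) \<and>
      ?\<Phi> n (r n) - ?\<Phi> n (s n) = (r n - s n) * ?\<Phi>' n \<xi>"
    using mvt_between[OF has_derivative_tanh_mult] by blast
  then obtain \<xi> where \<xi>: "\<And>n. min (r n) (s n) \<le> \<xi> n" "\<And>n. \<xi> n \<le> max (r n) (s n)"
    "\<And>n. ?\<Phi> n (r n) - ?\<Phi> n (s n) = (r n - s n) * ?\<Phi>' n (\<xi> n)"
    by metis
  have "\<forall>n. \<exists>\<eta>. min (r n) (s n) \<le> \<eta> \<and> \<eta> \<le> max (r n) (s n) \<and>
      ln (cosh (r n)) - ln (cosh (s n)) = (r n - s n) * tanh \<eta>"
    using mvt_between[OF has_derivative_ln_cosh] by blast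
  then obtain \<eta> where \<eta>: "\<And>n. min (r n) (s n) \<le> \<eta> n" "\<And>n. \<eta> n \<le> max (r n) (s n)"
    "\<And>n. ln (cosh (r n)) - ln (cosh (s n)) = (r n - s n) * tanh (\<eta> n)"
    by metis
  have between: "z \<longlonglongrightarrow> c" if "\<And>n. min (r n) (s n) \<le> z n" "\<And>n. z n \<le> max (r n) (s n)" for z
    using tendsto_min[OF rc sc] tendsto_max[OF rc sc] that
    by (intro tendsto_sandwich[of "\<lambda>n. min (r n) (s n)" z sequentially "\<lambda>n. max (r n) (s n)" c]) auto
  have \<xi>c: "\<xi> \<longlonglongrightarrow> c" and \<eta>c: "\<eta> \<longlonglongrightarrow> c" using between \<xi> \<eta> by blast+
  have \<xi>T: "filterlim (\<lambda>n. \<xi> n * T n / 2) at_top sequentially"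
    using filterlim_tendsto_pos_mult_at_top[OF \<xi>c c T]
      filterlim_tendsto_pos_mult_at_top[OF tendsto_const[of "1/2"], of "\<lambda>n. \<xi> n * T n" sequentially] by simp
  have th1: "(\<lambda>n. tanh (\<xi> n * T n / 2)) \<longlonglongrightarrow> 1"
    by (rule filterlim_compose[OF tanh_real_at_top \<xi>T])
  have half_c: "c / 2 < c" using c by simp
  have th2: "(\<lambda>n. (1 - (tanh (\<xi> n * T n / 2))\<^sup>2) * (T n / 2)) \<longlonglongrightarrow> 0"
  proof (rule tendsto_0_le)
    have "((\<lambda>x. (1 - (tanh (c / 4 * x))\<^sup>2) * (x / 2)) \<longlongrightarrow> 0) at_top"
      unfolding tanh_altdef using c by real_asymp
    from filterlim_compose[OF this T]
    show "(\<lambda>n. (1 - (tanh (c / 4 * T n))\<^sup>2) * (T n / 2)) \<longlonglongrightarrow> 0" .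
    show "\<forall>\<^sub>F n in sequentially. norm ((1 - (tanh (\<xi> n * T n / 2))\<^sup>2) * (T n / 2)) \<le>
        norm ((1 - (tanh (c / 4 * T n))\<^sup>2) * (T n / 2)) * 1"
      using eventually_T_pos order_tendstoD(1)[OF \<xi>c half_c]
    proof eventually_elim
      case (elim n)
      have "c / 2 * T n \<le> \<xi> n * T n" using elim by (intro mult_right_mono) auto
      then have "c / 4 * T n \<le> \<xi> n * T n / 2" by simp
      then have "(tanh (c / 4 * T n))\<^sup>2 \<le> (tanh (\<xi> n * T n / 2))\<^sup>2"
        using c elim by (intro power_mono) auto
      moreover have "(tanh x)\<^sup>2 \<le> 1" for x :: real
        using tanh_real_bounds[of x] by (auto simp: abs_square_le_1)
      ultimately show ?case
        using elim by (simp add: abs_mult mult_right_mono)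
    qed
  qed
  have "(\<lambda>n. ?\<Phi>' n (\<xi> n)) \<longlonglongrightarrow> (1 - (tanh c)\<^sup>2) * 1 + tanh c * 0"
    by (intro tendsto_intros th1 th2 \<xi>c) auto
  then have \<Phi>': "(\<lambda>n. ?\<Phi>' n (\<xi> n)) \<longlonglongrightarrow> 1 - (tanh c)\<^sup>2" by simp
  have tc: "1 - (tanh c)\<^sup>2 > 0"
    using power_strict_mono[of "tanh c" 1 2] tanh_real_lt_1[of c] c by simp
  have "(\<lambda>n. tanh (s n) * (L n * (1 - cos (\<theta> n)) * exp (- c * T n)) / (exp (- c * T n) * sinh (s n * T n)))
      \<longlonglongrightarrow> tanh c * q / (1 / 2)"
    by (intro tendsto_intros sc q sinh_pin_root_tendsto[OF root]) auto
  moreover have "\<forall>\<^sub>F n in sequentially. tanh (s n) * (L n * (1 - cos (\<theta> n)) * exp (- c * T n))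
      / (exp (- c * T n) * sinh (s n * T n)) = L n * (r n - s n) * ?\<Phi>' n (\<xi> n)"
    using root root0 eventually_T_pos
  proof eventually_elim
    case (elim n)
    have pos: "s n > 0" "r n > 0" using elim c by (auto simp: pin_root_def)
    have S: "sinh (s n * T n) > 0" "sinh (r n * T n) > 0" using pos elim by auto
    have solve: "x = y * (z / w)" if "x * w = y * z" "w > 0" for x y z w :: real
      using that by (simp add: field_simps)
    have "tanh c = tanh (r n) * ((cosh (r n * T n) - 1) / sinh (r n * T n))"
      by (rule solve) (use elim(2) S in \<open>auto simp: pin_root_def\<close>)
    also have "\<dots> = ?\<Phi> n (r n)"
      using pos elim by (subst cosh_minus_1_div_sinh) auto
    finally have 1: "?\<Phi> n (r n) = tanh c" by simp
    have "tanh c = tanh (s n) * ((cosh (s n * T n) - cos (\<theta> n)) / sinh (s n * T n))"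
      by (rule solve) (use elim(1) S in \<open>auto simp: pin_root_def\<close>)
    also have "(cosh (s n * T n) - cos (\<theta> n)) / sinh (s n * T n) =
        (cosh (s n * T n) - 1) / sinh (s n * T n) + (1 - cos (\<theta> n)) / sinh (s n * T n)"
      by (simp add: diff_divide_distrib)
    also have "(cosh (s n * T n) - 1) / sinh (s n * T n) = tanh (s n * T n / 2)"
      using pos elim by (subst cosh_minus_1_div_sinh) auto
    finally have 2: "tanh c = ?\<Phi> n (s n) + tanh (s n) * ((1 - cos (\<theta> n)) / sinh (s n * T n))"
      by (simp add: distrib_left)
    have "L n * (r n - s n) * ?\<Phi>' n (\<xi> n) = L n * (?\<Phi> n (r n) - ?\<Phi> n (s n))"
      unfolding \<xi>(3) by (simp only: mult.assoc)
    also have "\<dots> = L n * (tanh (s n) * ((1 - cos (\<theta> n)) / sinh (s n * T n)))"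
      using 1 2 by simp
    finally show ?case by (simp add: mult_ac)
  qed
  ultimately have "(\<lambda>n. L n * (r n - s n) * ?\<Phi>' n (\<xi> n)) \<longlonglongrightarrow> tanh c * q / (1 / 2)"
    by (rule Lim_transform_eventually)
  then have "(\<lambda>n. L n * (r n - s n) * ?\<Phi>' n (\<xi> n) / ?\<Phi>' n (\<xi> n)) \<longlonglongrightarrow> tanh c * q / (1 / 2) / (1 - (tanh c)\<^sup>2)"
    by (intro tendsto_divide \<Phi>') (use tc in auto)
  moreover have "\<forall>\<^sub>F n in sequentially. L n * (r n - s n) * ?\<Phi>' n (\<xi> n) / ?\<Phi>' n (\<xi> n) = L n * (r n - s n)"
    using order_tendstoD(1)[OF \<Phi>' tc] by eventually_elim simp
  ultimately have "(\<lambda>n. L n * (r n - s n)) \<longlonglongrightarrow> tanh c * q / (1 / 2) / (1 - (tanh c)\<^sup>2)"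
    by (rule Lim_transform_eventually)
  then have "(\<lambda>n. - (L n * (r n - s n) * tanh (\<eta> n))) \<longlonglongrightarrow> - (tanh c * q / (1 / 2) / (1 - (tanh c)\<^sup>2) * tanh c)"
    by (intro tendsto_intros \<eta>c) auto
  moreover have "- (L n * (r n - s n) * tanh (\<eta> n)) = L n * (ln (cosh (s n)) - ln (cosh (r n)))" for n
    using arg_cong[OF \<eta>(3)[of n], of "\<lambda>x. - (L n * x)"] by (simp add: algebra_simps)
  moreover have "tanh c * q / (1 / 2) / (1 - (tanh c)\<^sup>2) * tanh c = 2 * q * (sinh c)\<^sup>2"
  proof -
    have "1 - (tanh c)\<^sup>2 = 1 / (cosh c)\<^sup>2"
      using cosh_power2_mult_tanh[of c] by (simp add: eq_divide_eq mult.commute)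
    moreover have "sinh c = tanh c * cosh c" by (simp add: tanh_def)
    ultimately show ?thesis by (simp add: power2_eq_square)
  qed
  ultimately show ?thesis by simp
qed

end

section \<open>The limit theorem\<close>

lemma exp_2_c_delta:
  assumes "\<delta> > 0"
  shows "exp (2 * c_delta \<delta>) = 2 * exp \<delta> - 1"
proof -
  have "exp (- \<delta>) < 1" using assms by simp
  then have p: "2 - exp (- \<delta>) > 0" by linarith
  have "2 * c_delta \<delta> = \<delta> + ln (2 - exp (- \<delta>))"
    using p by (simp add: c_delta_def ln_sqrt)
  then have "exp (2 * c_delta \<delta>) = exp \<delta> * (2 - exp (- \<delta>))"
    using p by (simp add: exp_add)
  then show ?thesis by (simp add: right_diff_distrib exp_minus)
qed

lemma c_delta_pos:
  assumes "\<delta> > 0"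
  shows "c_delta \<delta> > 0"
proof -
  have "exp (2 * c_delta \<delta>) > 1"
    unfolding exp_2_c_delta[OF assms] using assms by simp
  then show ?thesis by simp
qed

lemma tanh_c_delta:
  assumes "\<delta> > 0"
  shows "tanh (c_delta \<delta>) = 1 - exp (- \<delta>)"
proof -
  define E where "E = exp \<delta>"
  have E: "E > 1" using assms by (simp add: E_def)
  have "exp (- 2 * c_delta \<delta>) = 1 / (2 * E - 1)"
    using exp_2_c_delta[OF assms] by (simp add: E_def exp_minus inverse_eq_divide)
  then have "tanh (c_delta \<delta>) = (1 - 1 / (2 * E - 1)) / (1 + 1 / (2 * E - 1))"
    by (simp only: tanh_real_altdef)
  also have "\<dots> = 1 - 1 / E" using E by (simp add: divide_simps)
  finally show ?thesis by (simp add: E_def exp_minus inverse_eq_divide)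
qed

lemma C_delta_power2:
  assumes "\<delta> > 0"
  shows "(C_delta \<delta>)\<^sup>2 = 2 * (sinh (c_delta \<delta>))\<^sup>2"
proof -
  define \<tau> where "\<tau> = tanh (c_delta \<delta>)"
  have "exp (- \<delta>) < 1" using assms by simp
  then have e: "2 - exp (- \<delta>) > 0" by linarith
  have \<tau>: "\<tau> = 1 - exp (- \<delta>)" unfolding \<tau>_def by (rule tanh_c_delta[OF assms])
  have "(cosh (c_delta \<delta>))\<^sup>2 * (1 - \<tau>\<^sup>2) = 1"
    unfolding \<tau>_def by (rule cosh_power2_mult_tanh)
  moreover have "1 - \<tau>\<^sup>2 = exp (- \<delta>) * (2 - exp (- \<delta>))"
    unfolding \<tau> by (simp add: power2_eq_square algebra_simps)
  ultimately have "(cosh (c_delta \<delta>))\<^sup>2 * (2 - exp (- \<delta>)) = exp \<delta>"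
    by (simp add: exp_minus field_simps)
  then have ch: "(cosh (c_delta \<delta>))\<^sup>2 = exp \<delta> / (2 - exp (- \<delta>))"
    using e by (simp only: eq_divide_eq) simp
  have "sinh (c_delta \<delta>) = \<tau> * cosh (c_delta \<delta>)" by (simp add: \<tau>_def tanh_def)
  then have "2 * (sinh (c_delta \<delta>))\<^sup>2 = \<tau>\<^sup>2 * (2 * exp \<delta> / (2 - exp (- \<delta>)))"
    using ch by (simp add: power_mult_distrib)
  also have "\<dots> = (C_delta \<delta>)\<^sup>2"
    using e unfolding C_delta_def \<tau> by (simp add: power_mult_distrib)
  finally show ?thesis by simp
qed

lemma C_delta_pos:
  assumes "\<delta> > 0"
  shows "C_delta \<delta> > 0"
proof -
  have e: "exp (- \<delta>) < 1" using assms by simp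
  then have "2 - exp (- \<delta>) > 0" by linarith
  with e show ?thesis
    unfolding C_delta_def by (intro mult_pos_pos real_sqrt_gt_zero divide_pos_pos) auto
qed

lemma twisted_partition_asymp:
  fixes \<delta> :: real and M :: "nat \<Rightarrow> nat" and u s r :: "nat \<Rightarrow> real"
  defines "c \<equiv> c_delta \<delta>"
  assumes \<delta>: "\<delta> > 0" and M: "filterlim M at_top sequentially" and M_le: "\<And>n. M n \<le> n"
    and \<theta>: "(\<lambda>n. 2 * u n * real (M n)) \<longlonglongrightarrow> 0"
    and root: "eventually (\<lambda>n. pin_root c (2 * real (M n)) (2 * u n * real (M n)) (s n)) sequentially"
    and root0: "eventually (\<lambda>n. pin_root c (2 * real (M n)) 0 (r n)) sequentially"
    and q: "(\<lambda>n. real (2 * (n div 2)) * (1 - cos (2 * u n * real (M n))) * exp (- c * (2 * real (M n)))) \<longlonglongrightarrow> q"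
  shows "(\<lambda>n. of_real (exp \<delta>) * twisted_partition \<delta> (2 * M n) (u n) (2 * (n div 2)) 0
      / of_real (cosh (r n) ^ (2 * (n div 2))))
    \<longlonglongrightarrow> of_real (amplitude_limit \<delta> c * exp (- (2 * q * (sinh c)\<^sup>2)))"
proof -
  let ?\<theta> = "\<lambda>n. 2 * u n * real (M n)" and ?k = "\<lambda>n::nat. n div 2"
  define Z where "Z = (\<lambda>n. complex_of_real (exp \<delta>) * twisted_partition \<delta> (2 * M n) (u n) (2 * ?k n) 0)"
  define a where "a = (\<lambda>n. pin_amplitude \<delta> (M n) (?\<theta> n) (s n))"
  have c: "c > 0" unfolding c_def by (rule c_delta_pos[OF \<delta>])
  have "filterlim (\<lambda>n. real (M n)) at_top sequentially"
    by (rule filterlim_compose[OF filterlim_real_sequentially M])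
  then have T: "filterlim (\<lambda>n. 2 * real (M n)) at_top sequentially"
    by (intro filterlim_tendsto_pos_mult_at_top[OF tendsto_const]) auto
  have s: "s \<longlonglongrightarrow> c" by (rule pin_root_tendsto[OF c T root])
  have a: "a \<longlonglongrightarrow> of_real (amplitude_limit \<delta> c)"
    unfolding a_def by (rule pin_amplitude_tendsto[OF c \<delta> M s \<theta>])
  have "(\<lambda>n. exp (real (2 * ?k n) * (ln (cosh (s n)) - ln (cosh (r n))))) \<longlonglongrightarrow> exp (- (2 * q * (sinh c)\<^sup>2))"
    by (intro tendsto_exp log_eigenvalue_gap_tendsto[OF c T root root0 q])
  moreover have "exp (real (2 * ?k n) * (ln (cosh (s n)) - ln (cosh (r n))))
      = cosh (s n) ^ (2 * ?k n) / cosh (r n) ^ (2 * ?k n)" for n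
    unfolding right_diff_distrib exp_diff exp_of_nat_mult by simp
  ultimately have ratio: "(\<lambda>n. cosh (s n) ^ (2 * ?k n) / cosh (r n) ^ (2 * ?k n)) \<longlonglongrightarrow> exp (- (2 * q * (sinh c)\<^sup>2))"
    by simp
  have main: "(\<lambda>n. a n * of_real (cosh (s n) ^ (2 * ?k n) / cosh (r n) ^ (2 * ?k n))) \<longlonglongrightarrow>
      of_real (amplitude_limit \<delta> c) * of_real (exp (- (2 * q * (sinh c)\<^sup>2)))"
    by (intro tendsto_mult a tendsto_of_real ratio)
  define b where "b = cosh (c / 2)"
  have "cosh 0 < cosh (c / 2)" using c by (subst cosh_real_nonneg_less_iff) auto
  then have b: "b > 1" by (simp add: b_def)
  have err: "(\<lambda>n. Z n / of_real (cosh (r n) ^ (2 * ?k n))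
      - a n * of_real (cosh (s n) ^ (2 * ?k n) / cosh (r n) ^ (2 * ?k n))) \<longlonglongrightarrow> 0"
  proof (rule tendsto_0_le)
    show "(\<lambda>n. real n * (1 / b) ^ n) \<longlonglongrightarrow> 0"
      using b by (intro powser_times_n_limit_0) simp
    show "\<forall>\<^sub>F n in sequentially. norm (Z n / of_real (cosh (r n) ^ (2 * ?k n))
      - a n * of_real (cosh (s n) ^ (2 * ?k n) / cosh (r n) ^ (2 * ?k n)))
      \<le> norm (real n * (1 / b) ^ n) * (exp \<delta> * b)"
      using root root0 M[unfolded filterlim_at_top, rule_format, of 1]
    proof eventually_elim
      case (elim n)
      let ?W = "plane_wave \<delta> (M n) (?\<theta> n / real (M n))"
      have M0: "M n > 0" using elim by simp
      have s0: "s n > 0" and r0: "c / 2 \<le> r n" using elim c by (auto simp: pin_root_def)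
      have "tanh c * sinh (2 * s n * real (M n)) = tanh (s n) * (cosh (2 * s n * real (M n)) - cos (?\<theta> n))"
        using elim(1) by (simp add: pin_root_def mult_ac)
      then have "pinned_eigenfunction \<delta> (M n) (?\<theta> n) (pin_eigenfun (M n) (?\<theta> n) (s n)) ((cosh (s n))\<^sup>2)"
        unfolding c_def tanh_c_delta[OF \<delta>] by (rule pinned_eigenfunction_pin_eigenfun[OF M0 s0])
      from pinned_eigenfunction.iterate_pin_op_at_0[OF this quasi_periodic_plane_wave[OF M0], of "?k n" \<delta>]
      have "cmod ((pin_op \<delta> (M n) ^^ ?k n) ?W 0 - a n * of_real ((cosh (s n))\<^sup>2 ^ ?k n))
          \<le> sqrt (exp \<delta> * pin_norm2 \<delta> (M n) ?W)"
        unfolding a_def pin_amplitude_def .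
      also have "(pin_op \<delta> (M n) ^^ ?k n) ?W 0 = Z n"
        using twisted_partition_even[of \<delta> "M n" 0 "u n" "?k n"] M0
        by (simp add: Z_def plane_wave_def[abs_def] pin_weight_def)
      also have "sqrt (exp \<delta> * pin_norm2 \<delta> (M n) ?W) \<le> sqrt (exp \<delta> * (exp \<delta> * real n))"
        using order_trans[OF pin_norm2_plane_wave[OF \<delta>, of "M n" "?\<theta> n / real (M n)"],
          of "exp \<delta> * real n"] M_le[of n]
        by (intro real_sqrt_le_mono mult_left_mono) auto
      also have "\<dots> = exp \<delta> * sqrt (real n)"
        by (simp add: real_sqrt_mult flip: mult.assoc)
      also have "\<dots> \<le> exp \<delta> * real n"
        using M_le[of n] M0 by (intro mult_left_mono real_le_lsqrt) (auto simp: power2_eq_square)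
      finally have bd: "cmod (Z n - a n * of_real (cosh (s n) ^ (2 * ?k n))) \<le> exp \<delta> * real n"
        by (simp add: power_mult)
      have "b \<le> cosh (r n)" unfolding b_def using c r0 by (subst cosh_real_nonneg_le_iff) auto
      then have "b ^ (2 * ?k n) \<le> cosh (r n) ^ (2 * ?k n)" using b by (intro power_mono) auto
      moreover have "b ^ n \<le> b ^ Suc (2 * ?k n)" using b by (intro power_increasing) auto
      ultimately have pw: "b ^ n \<le> b * cosh (r n) ^ (2 * ?k n)"
        using b by (smt (verit) mult_left_mono power_Suc)
      have "Z n / of_real (cosh (r n) ^ (2 * ?k n)) - a n * of_real (cosh (s n) ^ (2 * ?k n) / cosh (r n) ^ (2 * ?k n))
        = (Z n - a n * of_real (cosh (s n) ^ (2 * ?k n))) / of_real (cosh (r n) ^ (2 * ?k n))"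
        by (simp add: diff_divide_distrib)
      then have "norm (Z n / of_real (cosh (r n) ^ (2 * ?k n)) - a n * of_real (cosh (s n) ^ (2 * ?k n) / cosh (r n) ^ (2 * ?k n)))
        = cmod (Z n - a n * of_real (cosh (s n) ^ (2 * ?k n))) / cosh (r n) ^ (2 * ?k n)"
        by (simp add: norm_divide norm_power)
      also have "\<dots> \<le> exp \<delta> * real n / (b ^ n / b)"
        using bd pw b by (intro frac_le) (auto simp: divide_le_eq mult.commute)
      also have "\<dots> = norm (real n * (1 / b) ^ n) * (exp \<delta> * b)"
        using b by (simp add: field_simps power_divide)
      finally show ?case .
    qed
  qed
  show ?thesis
    using tendsto_add[OF err main] unfolding Z_def by simp
qed

theorem theorem2:
  fixes \<delta> :: real and T :: "nat \<Rightarrow> nat"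
  assumes "\<delta> > 0"
    and "\<And>N. even (T N)"
    and "\<And>N. T N \<le> N"
    and "filterlim (\<lambda>N. real (T N)) at_top sequentially"
    and "filterlim (\<lambda>N. real (T N) - ln (real N) / c_delta \<delta>) at_bot sequentially"
  shows "weak_conv_m
           (\<lambda>N. distr (polymer (T N) N \<delta>) borel
              (\<lambda>xs. real_of_int (walk_pos xs N) /
                 (C_delta \<delta> * exp (- c_delta \<delta> * real (T N) / 2) * real (T N) * sqrt (real N))))
           std_normal_distribution"
proof (rule levy_continuity)
  show distr: "real_distribution (distr (polymer (T N) N \<delta>) borel (\<lambda>xs. real_of_int (walk_pos xs N) /
       (C_delta \<delta> * exp (- c_delta \<delta> * real (T N) / 2) * real (T N) * sqrt (real N))))" for N
    by (intro prob_space.real_distribution_distr prob_space_polymer measurable_polymer)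
  show "real_distribution std_normal_distribution" by (rule real_dist_normal_dist)
  fix t :: real
  define c where "c = c_delta \<delta>"
  define C where "C = C_delta \<delta>"
  define M where "M = (\<lambda>n. T n div 2)"
  define b where "b = (\<lambda>n. C * exp (- c * real (T n) / 2) * real (T n) * sqrt (real n))"
  define u where "u = (\<lambda>n. t / b n)"
  define \<theta> where "\<theta> = (\<lambda>n. 2 * u n * real (M n))"
  have \<delta>: "\<delta> > 0" by fact
  have c: "c > 0" unfolding c_def by (rule c_delta_pos[OF \<delta>])
  have C: "C > 0" unfolding C_def by (rule C_delta_pos[OF \<delta>])
  have TM: "T n = 2 * M n" for n using assms(2)[of n] by (simp add: M_def)
  have TMr: "real (T n) = 2 * real (M n)" for n by (simp add: TM)
  have Tlim: "filterlim (\<lambda>n. 2 * real (M n)) at_top sequentially"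
    using assms(4) unfolding TMr .
  have M_le: "M n \<le> n" for n using assms(3)[of n] by (simp add: M_def)
  have "filterlim (\<lambda>n. 1 / 2 * (2 * real (M n))) at_top sequentially"
    by (rule filterlim_tendsto_pos_mult_at_top[OF tendsto_const _ Tlim]) auto
  then have "filterlim (\<lambda>n. real (M n)) at_top sequentially" by simp
  then have M: "filterlim M at_top sequentially"
    by (simp add: filterlim_sequentially_iff_filterlim_real)
  have "(\<lambda>n. char (distr (polymer (T n) n \<delta>) borel (\<lambda>xs. real_of_int (walk_pos xs n) / b n)) t)
      \<longlonglongrightarrow> char std_normal_distribution t"
  proof (cases "t = 0")
    case True
    have "char (distr (polymer (T n) n \<delta>) borel (\<lambda>xs. real_of_int (walk_pos xs n) / b n)) t = 1" for n
      using real_distribution.char_zero[OF distr[of n]] True by (simp add: b_def c_def C_def)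
    then show ?thesis
      using True real_distribution.char_zero[OF real_dist_normal_dist] by simp
  next
    case False
    have good: "eventually (\<lambda>n. n > 0 \<and> M n > 0) sequentially"
      using eventually_gt_at_top[of "0::nat"] M[unfolded filterlim_at_top, rule_format, of 1]
      by eventually_elim simp
    have \<theta>_eq: "\<theta> n = t / C * exp (c * real (T n) / 2) / sqrt (real n)" if "n > 0" "M n > 0" for n
      using that C by (simp add: \<theta>_def u_def b_def TMr exp_minus field_simps)
    have \<theta>0: "\<theta> \<longlonglongrightarrow> 0"
    proof -
      have "filterlim (\<lambda>n. c / 2 * (real (T n) - ln (real n) / c)) at_bot sequentially"
        using assms(5) c
        by (intro filterlim_tendsto_pos_mult_at_bot[OF tendsto_const]) (auto simp: c_def)
      then have "(\<lambda>n. exp (c / 2 * (real (T n) - ln (real n) / c))) \<longlonglongrightarrow> 0"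
        by (rule filterlim_compose[OF exp_at_bot])
      from tendsto_mult_right_zero[OF this, of "t / C"]
      have "(\<lambda>n. t / C * exp (c / 2 * (real (T n) - ln (real n) / c))) \<longlonglongrightarrow> 0" .
      moreover have "eventually (\<lambda>n. t / C * exp (c / 2 * (real (T n) - ln (real n) / c)) = \<theta> n) sequentially"
        using good
      proof eventually_elim
        case (elim n)
        have "exp (ln (real n) / 2) = sqrt (real n)"
          using elim by (simp add: ln_sqrt[symmetric])
        moreover have "c / 2 * (real (T n) - ln (real n) / c) = c * real (T n) / 2 - ln (real n) / 2"
          using c by (simp add: field_simps)
        ultimately have "exp (c / 2 * (real (T n) - ln (real n) / c)) = exp (c * real (T n) / 2) / sqrt (real n)"
          by (simp only: exp_diff)
        then show ?case using elim by (simp add: \<theta>_eq)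
      qed
      ultimately show ?thesis by (rule Lim_transform_eventually)
    qed
    have \<theta>_at: "filterlim \<theta> (at 0) sequentially"
      unfolding filterlim_at
    proof
      show "\<forall>\<^sub>F n in sequentially. \<theta> n \<in> UNIV \<and> \<theta> n \<noteq> 0"
        using good by eventually_elim (use C False in \<open>simp add: \<theta>_eq\<close>)
    qed (rule \<theta>0)
    have half: "(\<lambda>n. real (2 * (n div 2)) / real n) \<longlonglongrightarrow> 1"
    proof (rule tendsto_sandwich)
      show "(\<lambda>n. 1 - 1 / real n) \<longlonglongrightarrow> 1" by real_asymp
      show "\<forall>\<^sub>F n in sequentially. 1 - 1 / real n \<le> real (2 * (n div 2)) / real n"
        using eventually_gt_at_top[of "0::nat"]
      proof eventually_elim
        case (elim n)
        have "n \<le> 2 * (n div 2) + 1" by simp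
        then have "(real n - 1) / real n \<le> real (2 * (n div 2)) / real n"
          by (intro divide_right_mono) linarith+
        then show ?case using elim by (simp add: diff_divide_distrib)
      qed
      show "\<forall>\<^sub>F n in sequentially. real (2 * (n div 2)) / real n \<le> 1"
        using eventually_gt_at_top[of "0::nat"]
      proof eventually_elim
        case (elim n)
        have "2 * (n div 2) \<le> n" by simp
        then have "real (2 * (n div 2)) \<le> real n" by linarith
        then show ?case using elim by simp
      qed
    qed auto
    have q: "(\<lambda>n. real (2 * (n div 2)) * (1 - cos (2 * u n * real (M n))) * exp (- c * (2 * real (M n))))
        \<longlonglongrightarrow> t\<^sup>2 / (2 * C\<^sup>2)"
    proof -
      have "((\<lambda>x::real. (1 - cos x) / x\<^sup>2) \<longlongrightarrow> 1 / 2) (at 0)" by real_asymp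
      from filterlim_compose[OF this \<theta>_at]
      have "(\<lambda>n. real (2 * (n div 2)) / real n * ((1 - cos (\<theta> n)) / (\<theta> n)\<^sup>2) * (t\<^sup>2 / C\<^sup>2)) \<longlonglongrightarrow> 1 * (1 / 2) * (t\<^sup>2 / C\<^sup>2)"
        by (intro tendsto_mult half tendsto_const)
      moreover have "eventually (\<lambda>n. real (2 * (n div 2)) / real n * ((1 - cos (\<theta> n)) / (\<theta> n)\<^sup>2) * (t\<^sup>2 / C\<^sup>2)
          = real (2 * (n div 2)) * (1 - cos (2 * u n * real (M n))) * exp (- c * (2 * real (M n)))) sequentially"
        using good
      proof eventually_elim
        case (elim n)
        have "(exp (c * real (T n) / 2))\<^sup>2 = exp (c * real (T n))"
          by (simp add: exp_double[symmetric])
        then have sq: "(\<theta> n)\<^sup>2 = t\<^sup>2 / C\<^sup>2 * exp (c * real (T n)) / real n"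
          using elim by (simp add: \<theta>_eq power_mult_distrib power_divide)
        have "real (2 * (n div 2)) / real n * ((1 - cos (\<theta> n)) / (\<theta> n)\<^sup>2) * (t\<^sup>2 / C\<^sup>2)
            = real (2 * (n div 2)) * (1 - cos (\<theta> n)) / exp (c * real (T n))"
          unfolding sq using False C elim by (simp add: divide_simps)
        then show ?case
          by (simp add: \<theta>_def TMr exp_minus divide_inverse)
      qed
      ultimately show ?thesis by (auto dest: Lim_transform_eventually)
    qed
    have ex: "eventually (\<lambda>n. \<forall>\<theta>. \<exists>s. pin_root c (2 * real (M n)) \<theta> s) sequentially"
      by (rule eventually_compose_filterlim[OF pin_root_exists[OF c] Tlim])
    define s where "s = (\<lambda>n. SOME s. pin_root c (2 * real (M n)) (2 * u n * real (M n)) s)"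
    define r where "r = (\<lambda>n. SOME s. pin_root c (2 * real (M n)) 0 s)"
    have root: "eventually (\<lambda>n. pin_root c (2 * real (M n)) (2 * u n * real (M n)) (s n)) sequentially"
      using ex unfolding s_def by eventually_elim (blast intro: someI_ex)
    have root0: "eventually (\<lambda>n. pin_root c (2 * real (M n)) 0 (r n)) sequentially"
      using ex unfolding r_def by eventually_elim (blast intro: someI_ex)
    let ?Z = "\<lambda>u n. twisted_partition \<delta> (2 * M n) u (2 * (n div 2)) 0"
    let ?A = "amplitude_limit \<delta> c"
    have A: "?A > 0" by (rule amplitude_limit_pos[OF c \<delta>])
    have Z1: "(\<lambda>n. of_real (exp \<delta>) * ?Z (u n) n / of_real (cosh (r n) ^ (2 * (n div 2))))
      \<longlonglongrightarrow> of_real (?A * exp (- (2 * (t\<^sup>2 / (2 * C\<^sup>2)) * (sinh c)\<^sup>2)))"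
      using twisted_partition_asymp[OF \<delta> M M_le, of u s r] \<theta>0 root root0 q
      unfolding \<theta>_def c_def by blast
    have Z0: "(\<lambda>n. of_real (exp \<delta>) * ?Z 0 n / of_real (cosh (r n) ^ (2 * (n div 2)))) \<longlonglongrightarrow> of_real ?A"
      using twisted_partition_asymp[OF \<delta> M M_le, of "\<lambda>_. 0" r r 0] root0
      unfolding c_def by simp
    have lim: "(\<lambda>n. of_real (exp \<delta>) * ?Z (u n) n / of_real (cosh (r n) ^ (2 * (n div 2))) /
        (of_real (exp \<delta>) * ?Z 0 n / of_real (cosh (r n) ^ (2 * (n div 2)))))
      \<longlonglongrightarrow> of_real (?A * exp (- (2 * (t\<^sup>2 / (2 * C\<^sup>2)) * (sinh c)\<^sup>2))) / of_real ?A"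
      by (intro tendsto_divide Z1 Z0) (use A in simp)
    have gauss: "2 * (t\<^sup>2 / (2 * C\<^sup>2)) * (sinh c)\<^sup>2 = t\<^sup>2 / 2"
      using C_delta_power2[OF \<delta>] c by (simp add: C_def c_def)
    have ratio: "(\<lambda>n. ?Z (u n) n / ?Z 0 n) \<longlonglongrightarrow> of_real (exp (- (t\<^sup>2 / 2)))"
      using lim A unfolding gauss by simp
    have "(\<lambda>n. \<theta> n / (2 * real (M n))) \<longlonglongrightarrow> 0"
      by (rule tendsto_divide_0[OF \<theta>0 filterlim_at_top_imp_at_infinity[OF Tlim]])
    then have u0: "u \<longlonglongrightarrow> 0"
      by (rule Lim_transform_eventually) (use good in \<open>auto simp: \<theta>_def elim!: eventually_mono\<close>)
    have parity: "(\<lambda>n. complex_of_real (cos (u n) ^ (n mod 2))) \<longlonglongrightarrow> of_real 1"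
    proof (rule tendsto_of_real, rule LIM_zero_cancel, rule tendsto_0_le)
      show "(\<lambda>n. cos (u n) - 1) \<longlonglongrightarrow> 0"
        using tendsto_diff[OF tendsto_cos[OF u0] tendsto_const, of 1] by simp
      show "\<forall>\<^sub>F n in sequentially. norm (cos (u n) ^ (n mod 2) - 1) \<le> norm (cos (u n) - 1) * 1"
        by (rule always_eventually) (simp add: mod_2_eq_odd)
    qed
    have "char (distr (polymer (T n) n \<delta>) borel (\<lambda>xs. real_of_int (walk_pos xs n) / b n)) t
        = of_real (cos (u n) ^ (n mod 2)) * (?Z (u n) n / ?Z 0 n)" for n
    proof -
      have "twisted_partition \<delta> (2 * M n) v n 0 = of_real (cos v ^ (n mod 2)) * ?Z v n" for v
      proof (cases "even n")
        case True
        then show ?thesis by simp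
      next
        case odd: False
        then have "n = Suc (2 * (n div 2))" by simp
        then show ?thesis
          using twisted_partition_odd[of \<delta> "M n" v "n div 2" 0] odd by (simp add: odd_iff_mod_2_eq_one)
      qed
      then show ?thesis unfolding char_polymer TM u_def by simp
    qed
    moreover have "(\<lambda>n. of_real (cos (u n) ^ (n mod 2)) * (?Z (u n) n / ?Z 0 n)) \<longlonglongrightarrow>
        of_real 1 * of_real (exp (- (t\<^sup>2 / 2)))"
      by (intro tendsto_mult parity ratio)
    ultimately show ?thesis
      by (simp add: char_std_normal_distribution)
  qed
  then show "(\<lambda>n. char (distr (polymer (T n) n \<delta>) borel (\<lambda>xs. real_of_int (walk_pos xs n) /
       (C_delta \<delta> * exp (- c_delta \<delta> * real (T n) / 2) * real (T n) * sqrt (real n)))) t)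
    \<longlonglongrightarrow> char std_normal_distribution t"
    unfolding b_def c_def C_def .
qed

end
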